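(* Let $d\ge 1$ and let $H:\mathbb{R}^d\to\mathbb{R}$ satisfy assumptions (A) (regularity, coercivity, strict convexity) and (B) (uniform directional convexity) stated in the context. For every $M>0$ there exist constants $\gamma_M,\Lambda_M>0$, depending only on $M$ and $H$, such that the following holds. For every $t>0$ and every Lipschitz function $u_0:\mathbb{R}^d\to\mathbb{R}$ with Lipschitz constant $M$, the function $\mathbf{b}(t,\cdot)$ (the slope of backward optimal rays, defined in the context) has locally bounded total variation on $\mathbb{R}^d$, and for every open and bounded set $\Omega\subset\mathbb{R}^d$ of finite perimeter, its total variation over $\Omega$ satisfies \[ |D_x\mathbf{b}(t,\cdot)|(\Omega)\;\le\;\frac{1}{\gamma_M}\left(\Lambda_M+\frac{\mathrm{diam}(\Omega)}{t}\right)\mathcal{H}^{d-1}(\partial\Omega)+\frac{\sqrt d}{t}\,|\Omega| . \]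
   Context: Assumptions on $H:\mathbb{R}^d\to\mathbb{R}$: (A) $H\in\mathcal{C}^1(\mathbb{R}^d)$, $\lim_{|p|\to\infty}H(p)/|p|=+\infty$, and $H$ is strictly convex. (B) For every $r>0$, \[ \lambda_r:=\inf_{p\ne q\in\overline B(0,r)}\left\langle \frac{DH(p)-DH(q)}{|DH(p)-DH(q)|},\frac{p-q}{|p-q|}\right\rangle>0 . \] Here $|\cdot|$ and $\langle\cdot,\cdot\rangle$ are the Euclidean norm and inner product, and $\overline B(0,r)$ is the closed ball. $L(q):=\max_{p\in\mathbb{R}^d}\{\langle p,q\rangle-H(p)\}$ is the Legendre transform of $H$. For Lipschitz $u_0$, the viscosity solution of $u_t+H(D_xu)=0$ on $(0,\infty)\times\mathbb{R}^d$ with $u(0,\cdot)=u_0$ is given by the Hopf-Lax formula $u(t,x)=\min_{y\in\mathbb{R}^d}\{u_0(y)+tL((x-y)/t)\}$. For $t>0$ set \[ C_{t,x}=\arg\min_{y\in\mathbb{R}^d}\left\{u_0(y)+tL\left(\tfrac{x-y}{t}\right)\right\},\qquad \mathbf{b}(t,x)=\left\{\tfrac{x-y}{t}:y\in C_{t,x}\right\}. \] For each $t>0$ and almost every $x\in\mathbb{R}^d$ the set $\mathbf{b}(t,x)$ is the singleton $\{DH(D_xu(t,x))\}$, and $\mathbf{b}(t,\cdot)$ is regarded as an element of $\mathbf{L}^\infty(\mathbb{R}^d;\mathbb{R}^d)$. For $f:\Omega\to\mathbb{R}^m$ the total variation is $|Df|(\Omega)=\sup\{\sum_{\alpha=1}^m\int_\Omega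 f^\alpha\,\mathrm{div}\,\varphi^\alpha\,dx:\varphi\in[\mathcal{C}^1_c(\Omega,\mathbb{R}^d)]^m,\ \|\varphi\|_\infty\le1\}$, where $\|\varphi\|_\infty$ is the supremum of the Euclidean (Frobenius) norm of $\varphi(x)\in\mathbb{R}^{m\times d}$. $\mathcal{H}^{d-1}$ is the $(d-1)$-dimensional Hausdorff measure, $\partial\Omega$ the topological boundary and $|\Omega|$ the Lebesgue measure of $\Omega$. *)

theory Defs
  imports "HOL-Analysis.Analysis"
begin

definition strictly_convex_on :: "'a::real_vector set \<Rightarrow> ('a \<Rightarrow> real) \<Rightarrow> bool" where
  "strictly_convex_on S f \<longleftrightarrow> convex S \<and>
     (\<forall>x\<in>S. \<forall>y\<in>S. \<forall>s. x \<noteq> y \<longrightarrow> 0 < s \<longrightarrow> s < 1 \<longrightarrow>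
        f ((1 - s) *\<^sub>R x + s *\<^sub>R y) < (1 - s) * f x + s * f y)"

definition C1_fun :: "(real^'n \<Rightarrow> 'b::real_normed_vector) \<Rightarrow> bool" where
  "C1_fun f \<longleftrightarrow> (\<forall>x. f differentiable (at x)) \<and>
     (\<forall>i. continuous_on UNIV (\<lambda>x. frechet_derivative f (at x) (axis i 1)))"

definition grad :: "(real^'n \<Rightarrow> real) \<Rightarrow> real^'n \<Rightarrow> real^'n" where
  "grad f x = (\<chi> i. frechet_derivative f (at x) (axis i 1))"

definition assumption_A :: "(real^'n \<Rightarrow> real) \<Rightarrow> bool" where
  "assumption_A H \<longleftrightarrow> C1_fun H
     \<and> filterlim (\<lambda>p. H p / norm p) at_top at_infinity
     \<and> strictly_convex_on UNIV H"

text \<open>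
  The quotients are bounded below by \<open>-1\<close>, so the infimum below is over a nonempty set of reals
  bounded below when \<open>r > 0\<close>. Under \<open>assumption_A\<close> the gradient is injective, so that
  the division by zero in the first quotient does not occur.
\<close>

definition convexity_modulus :: "(real^'n \<Rightarrow> real) \<Rightarrow> real \<Rightarrow> real" where
  "convexity_modulus H r =
     (INF (p, q) \<in> {(p, q). p \<in> cball 0 r \<and> q \<in> cball 0 r \<and> p \<noteq> q}.
        ((grad H p - grad H q) /\<^sub>R norm (grad H p - grad H q)) \<bullet> ((p - q) /\<^sub>R norm (p - q)))"

definition assumption_B :: "(real^'n \<Rightarrow> real) \<Rightarrow> bool" where
  "assumption_B H \<longleftrightarrow> (\<forall>r>0. convexity_modulus H r > 0)"

text \<open>Under \<open>assumption_A\<close> the supremum is finite and attained, i.e. it is a maximum.\<close>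

definition legendre :: "(real^'n \<Rightarrow> real) \<Rightarrow> real^'n \<Rightarrow> real" where
  "legendre H q = (SUP p. p \<bullet> q - H p)"

definition hopf_lax_minimizers ::
  "(real^'n \<Rightarrow> real) \<Rightarrow> (real^'n \<Rightarrow> real) \<Rightarrow> real \<Rightarrow> real^'n \<Rightarrow> (real^'n) set" where
  "hopf_lax_minimizers H u0 t x =
     {y. is_arg_min (\<lambda>y. u0 y + t * legendre H ((x - y) /\<^sub>R t)) (\<lambda>_. True) y}"

definition backward_slopes ::
  "(real^'n \<Rightarrow> real) \<Rightarrow> (real^'n \<Rightarrow> real) \<Rightarrow> real \<Rightarrow> real^'n \<Rightarrow> (real^'n) set" where
  "backward_slopes H u0 t x = (\<lambda>y. (x - y) /\<^sub>R t) ` hopf_lax_minimizers H u0 t x"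

text \<open>
  A representative of the almost everywhere defined function: \<open>backward_slopes H u0 t x\<close> is a
  singleton for almost every \<open>x\<close>, and the value elsewhere affects neither local
  integrability nor the total variation.
\<close>

definition backward_slope ::
  "(real^'n \<Rightarrow> real) \<Rightarrow> (real^'n \<Rightarrow> real) \<Rightarrow> real \<Rightarrow> real^'n \<Rightarrow> real^'n" where
  "backward_slope H u0 t x = (if is_singleton (backward_slopes H u0 t x)
      then the_elem (backward_slopes H u0 t x) else 0)"

definition div_vec :: "(real^'n \<Rightarrow> real^'n) \<Rightarrow> real^'n \<Rightarrow> real" where
  "div_vec F x = (\<Sum>i\<in>UNIV. frechet_derivative F (at x) (axis i 1) $ i)"

text \<open>
  Test fields on an open set \<open>\<Omega>\<close>, extended by zero to the whole space. The value is the matrix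
  with rows \<open>\<phi> x $ \<alpha>\<close>, and \<open>norm\<close> on the type of matrices is the Frobenius norm.
\<close>

definition test_fields :: "(real^'n) set \<Rightarrow> (real^'n \<Rightarrow> real^'n^'m) set" where
  "test_fields \<Omega> = {\<phi>. C1_fun \<phi> \<and> compact (closure {x. \<phi> x \<noteq> 0})
      \<and> closure {x. \<phi> x \<noteq> 0} \<subseteq> \<Omega> \<and> (\<forall>x. norm (\<phi> x) \<le> 1)}"

text \<open>
  Since \<open>ennreal\<close> sends negative reals to \<open>0\<close> and the zero field is a test field with integral
  \<open>0\<close>, this is the supremum of the real-valued expressions. It is meant for open \<open>\<Omega>\<close> and
  \<open>f\<close> locally integrable on \<open>\<Omega>\<close>; otherwise the Lebesgue integral may have its default value.
\<close>

definition total_variation :: "(real^'n \<Rightarrow> real^'m) \<Rightarrow> (real^'n) set \<Rightarrow> ennreal" where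
  "total_variation f \<Omega> =
     (SUP \<phi> \<in> test_fields \<Omega>.
        ennreal (\<Sum>\<alpha>\<in>UNIV. LINT x:\<Omega>|lebesgue. f x $ \<alpha> * div_vec (\<lambda>z. \<phi> z $ \<alpha>) x))"

definition locally_BV :: "(real^'n \<Rightarrow> real^'m) \<Rightarrow> bool" where
  "locally_BV f \<longleftrightarrow> (\<forall>K. compact K \<longrightarrow> set_integrable lebesgue K f)
     \<and> (\<forall>V. open V \<longrightarrow> bounded V \<longrightarrow> total_variation f V < \<infinity>)"

definition finite_perimeter :: "(real^'n) set \<Rightarrow> bool" where
  "finite_perimeter E \<longleftrightarrow> E \<in> sets lebesgue
     \<and> total_variation (\<lambda>x. vec (indicator E x) :: real^1) UNIV < \<infinity>"

text \<open>
  The Hausdorff measure of integer dimension \<open>k\<close>, with the normalisation for which it is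
  counting measure for \<open>k = 0\<close> and Lebesgue measure for \<open>k\<close> the dimension of the space. The
  empty set is treated separately because \<open>0 ^ 0 = 1\<close>; boundedness is required because
  \<open>diameter\<close> is only meaningful for bounded sets.
\<close>

definition hausdorff_content :: "nat \<Rightarrow> real \<Rightarrow> 'a::metric_space set \<Rightarrow> ennreal" where
  "hausdorff_content k \<delta> A =
     (INF C \<in> {C :: nat \<Rightarrow> 'a set. A \<subseteq> (\<Union>i. C i) \<and> (\<forall>i. bounded (C i) \<and> diameter (C i) \<le> \<delta>)}.
        \<Sum>i. if C i = {} then 0 else ennreal (unit_ball_vol (real k) * (diameter (C i) / 2) ^ k))"

definition hausdorff_measure :: "nat \<Rightarrow> 'a::metric_space set \<Rightarrow> ennreal" where
  "hausdorff_measure k A = (SUP \<delta> \<in> {0<..}. hausdorff_content k \<delta> A)"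

end

theory Submission
  imports Defs
begin

text \<open>
  Write \<open>b(x) = (x - y(x)) / t\<close>, where \<open>y(x)\<close> is the minimizer in the Hopf-Lax formula, the foot of the
  optimal ray through \<open>x\<close>. The identity contributes the volume term, and everything rests on one
  inequality between distributions,
  \<open>\<kappa> |D y| \<le> div y\<close> with \<open>\<kappa>\<close> the convexity modulus of \<open>H\<close> on a ball whose radius depends on \<open>M\<close> and
  \<open>H\<close> only (\<open>foot_derivative_le_divergence\<close>). It makes \<open>div y\<close> a nonnegative measure, and the
  divergence theorem bounds its mass in \<open>\<Omega>\<close> by the oscillation of \<open>y\<close>, at most
  \<open>diam \<Omega> + t R\<close> with \<open>R\<close> a bound on the speed, times the measure of the boundary.

  The inequality comes from a regularization. For a finite set \<open>Y\<close> of competitors, the minimum of the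
  functions \<open>x \<mapsto> u0 y + t L ((x - y) / t)\<close>, \<open>y \<in> Y\<close>, is replaced by its soft version at inverse
  temperature \<open>\<beta>\<close>, with Gibbs weights \<open>w\<^sub>y\<close>. The corresponding mean competitor is a continuously
  differentiable map with derivative
  \<open>(\<beta> / 2) \<Sum> w\<^sub>y w\<^sub>z (z - y) \<otimes> (p\<^sub>y - p\<^sub>z)\<close>, where \<open>p\<^sub>y = DL ((x - y) / t)\<close>. As \<open>DH\<close> inverts \<open>DL\<close>, one has
  \<open>z - y = t (DH p\<^sub>y - DH p\<^sub>z)\<close>, and the modulus in assumption (B) says exactly that the
  trace of each of these rank one matrices is at least \<open>\<kappa>\<close> times its norm. Hence the same holds for
  the sum, without any second derivative of \<open>H\<close> (\<open>soft_min_deriv_directional\<close>). The competitors whose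
  slope \<open>p\<^sub>y\<close> is too large have exponentially small weight. Refining \<open>Y\<close> and letting \<open>\<beta>\<close> tend to
  infinity fast enough, the means converge to \<open>y\<close> wherever the minimizer is unique
  (\<open>soft_min_approximation\<close>), and the inequality, integrated against test functions, survives
  dominated convergence.

  Uniqueness holds almost everywhere (\<open>AE_unique_minimizer\<close>): two minimizers with slopes that differ in
  the coordinate \<open>i\<close> produce a concave corner of the value function on the line through \<open>x\<close> in that
  direction, a function of one variable has only countably many corners, and Fubini's theorem
  concludes. The divergence theorem is used through cutoffs of \<open>\<Omega>\<close> built from coverings of its
  topological boundary by small balls (\<open>boundary_cutoff\<close>); this loses a constant depending on
  the dimension, which is absorbed in \<open>\<gamma>\<close>.
\<close>

section \<open>The Legendre transform\<close>

lemma C1_fun_derivative: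
  fixes f :: "real^'n \<Rightarrow> 'b::real_normed_vector"
  assumes "C1_fun f"
  shows "(f has_derivative frechet_derivative f (at x)) (at x)"
  using assms unfolding C1_fun_def by (simp add: frechet_derivative_works)

lemma linear_axis_expansion:
  fixes f :: "real^'n \<Rightarrow> 'b::real_vector"
  assumes "linear f"
  shows "f h = (\<Sum>i\<in>UNIV. (h $ i) *\<^sub>R f (axis i 1))"
proof -
  have "f h = f (\<Sum>i\<in>UNIV. (h $ i) *\<^sub>R axis i 1)"
    using basis_expansion[of h] by (simp add: scalar_mult_eq_scaleR)
  then show ?thesis
    using assms by (simp add: linear_sum linear_cmul)
qed

lemma grad_has_derivative:
  assumes "f differentiable (at x)"
  shows "(f has_derivative (\<lambda>h. grad f x \<bullet> h)) (at x)"
proof -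
  have d: "(f has_derivative frechet_derivative f (at x)) (at x)"
    using assms by (simp add: frechet_derivative_works)
  have "frechet_derivative f (at x) h = grad f x \<bullet> h" for h
    using linear_axis_expansion[OF has_derivative_linear[OF d], of h]
    by (simp add: grad_def inner_vec_def mult.commute)
  then have "frechet_derivative f (at x) = (\<lambda>h. grad f x \<bullet> h)" by blast
  with d show ?thesis by simp
qed

lemma continuous_on_grad:
  assumes "C1_fun f"
  shows "continuous_on UNIV (grad f)"
  using assms unfolding C1_fun_def grad_def by (auto intro!: continuous_on_vec_lambda)

locale hamiltonian =
  fixes H :: "real^'d \<Rightarrow> real"
  assumes A: "assumption_A H" and B: "assumption_B H"
begin

lemma H_C1: "C1_fun H"
  using A by (simp add: assumption_A_def)

lemma H_deriv: "(H has_derivative (\<lambda>h. grad H p \<bullet> h)) (at p)"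
  using H_C1 by (intro grad_has_derivative) (simp add: C1_fun_def)

lemma cont_H: "continuous_on UNIV H"
  using H_deriv by (meson continuous_at_imp_continuous_on has_derivative_continuous)

lemma cont_grad_H: "continuous_on S (grad H)"
  using continuous_on_grad[OF H_C1] continuous_on_subset by blast

lemma modulus_pos: "r > 0 \<Longrightarrow> convexity_modulus H r > 0"
  using B by (simp add: assumption_B_def)

lemma modulus_le_quotient:
  assumes "p \<in> cball 0 r" "q \<in> cball 0 r" "p \<noteq> q"
  shows "convexity_modulus H r \<le>
    ((grad H p - grad H q) /\<^sub>R norm (grad H p - grad H q)) \<bullet> ((p - q) /\<^sub>R norm (p - q))"
proof -
  let ?f = "\<lambda>(p, q). ((grad H p - grad H q) /\<^sub>R norm (grad H p - grad H q)) \<bullet> ((p - q) /\<^sub>R norm (p - q))"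
  let ?S = "{(p, q). p \<in> cball 0 r \<and> q \<in> cball 0 r \<and> p \<noteq> q}"
  have unit: "norm (v /\<^sub>R norm v) \<le> 1" for v :: "real^'d"
    by (cases "v = 0") auto
  have "- 1 \<le> ?f z" for z
  proof -
    obtain a b where z: "z = (a, b)" by force
    have "\<bar>?f z\<bar> \<le> norm ((grad H a - grad H b) /\<^sub>R norm (grad H a - grad H b)) * norm ((a - b) /\<^sub>R norm (a - b))"
      unfolding z prod.case by (rule Cauchy_Schwarz_ineq2)
    also have "\<dots> \<le> 1 * 1" by (intro mult_mono unit) auto
    finally show ?thesis by linarith
  qed
  then have "bdd_below (?f ` ?S)" by (auto intro!: bdd_belowI2)
  then have "(INF z\<in>?S. ?f z) \<le> ?f (p, q)"
    by (rule cINF_lower) (use assms in auto)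
  then show ?thesis
    by (simp add: convexity_modulus_def)
qed

text \<open>
  Whenever \<open>grad H p = grad H q\<close> with \<open>p \<noteq> q\<close>, the quotient defining the modulus vanishes, so the
  positivity of the modulus already contains the injectivity of the gradient.
\<close>

lemma inj_grad_H: "inj (grad H)"
proof (rule injI, rule ccontr)
  fix p q assume eq: "grad H p = grad H q" and ne: "p \<noteq> q"
  define r where "r = norm p + norm q"
  have "norm (p - q) \<le> r" unfolding r_def by (rule norm_triangle_ineq4)
  then have "r > 0" using ne by (smt (verit) zero_less_norm_iff right_minus_eq)
  moreover have "convexity_modulus H r \<le> 0"
    using modulus_le_quotient[of p r q] ne eq by (auto simp: r_def)
  ultimately show False using modulus_pos[of r] by linarith
qed

lemma directional_monotone:
  assumes "norm p \<le> r" "norm q \<le> r"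
  shows "convexity_modulus H r * (norm (grad H p - grad H q) * norm (p - q))
    \<le> (grad H p - grad H q) \<bullet> (p - q)"
proof (cases "p = q")
  case False
  then have pos: "norm (grad H p - grad H q) * norm (p - q) > 0"
    using inj_eq[OF inj_grad_H, of p q] False by simp
  have "convexity_modulus H r \<le> ((grad H p - grad H q) \<bullet> (p - q)) / (norm (grad H p - grad H q) * norm (p - q))"
    using modulus_le_quotient[of p r q] assms False
    by (simp only: mem_cball_0 inner_scaleR_left inner_scaleR_right) (simp add: divide_inverse mult_ac)
  then show ?thesis
    using pos by (simp add: pos_le_divide_eq)
qed simp

lemma monotone_grad: "0 \<le> (grad H p - grad H q) \<bullet> (p - q)"
proof -
  define r where "r = norm p + norm q + 1"
  have "0 < r" "norm p \<le> r" "norm q \<le> r" by (auto simp: r_def add_nonneg_pos)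
  then have "0 \<le> convexity_modulus H r * (norm (grad H p - grad H q) * norm (p - q))"
    using modulus_pos[of r] by (intro mult_nonneg_nonneg) auto
  also have "\<dots> \<le> (grad H p - grad H q) \<bullet> (p - q)"
    by (rule directional_monotone) fact+
  finally show ?thesis .
qed

lemma H_superlinear: "\<exists>r>0. \<forall>p. r \<le> norm p \<longrightarrow> K * norm p \<le> H p"
proof -
  have "filterlim (\<lambda>p. H p / norm p) at_top at_infinity"
    using A by (simp add: assumption_A_def)
  then have "eventually (\<lambda>p. K \<le> H p / norm p) at_infinity"
    by (simp add: filterlim_at_top)
  then obtain b where b: "\<And>p. b \<le> norm p \<Longrightarrow> K \<le> H p / norm p"
    by (auto simp: eventually_at_infinity)
  have "K * norm p \<le> H p" if "max b 1 \<le> norm p" for p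
  proof -
    have "K \<le> H p / norm p" "norm p > 0" using b[of p] that by auto
    then show ?thesis by (simp only: pos_le_divide_eq)
  qed
  then show ?thesis by (intro exI[of _ "max b 1"]) auto
qed

text \<open>Points that do at least as well as the origin in the Legendre transform are bounded, uniformly for bounded \<open>q\<close>.\<close>

lemma superlevel_bound:
  "\<exists>r. \<forall>p q. norm q \<le> R \<longrightarrow> 0 \<bullet> q - H 0 \<le> p \<bullet> q - H p \<longrightarrow> norm p \<le> r"
proof -
  obtain r where r: "r > 0" "\<And>p. r \<le> norm p \<Longrightarrow> (R + 1) * norm p \<le> H p"
    using H_superlinear by blast
  have "norm p \<le> max r \<bar>H 0\<bar>" if "norm q \<le> R" "0 \<bullet> q - H 0 \<le> p \<bullet> q - H p" for p q
  proof (cases "r \<le> norm p")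
    case True
    have "p \<bullet> q \<le> norm p * R"
      using norm_cauchy_schwarz[of p q] mult_left_mono[OF that(1), of "norm p"] by simp
    then show ?thesis using that(2) r(2)[OF True] by (simp add: algebra_simps)
  qed auto
  then show ?thesis by blast
qed

lemma legendre_attained: "\<exists>p. \<forall>p'. p' \<bullet> q - H p' \<le> p \<bullet> q - H p"
proof -
  obtain r where r: "\<And>p. 0 \<bullet> q - H 0 \<le> p \<bullet> q - H p \<Longrightarrow> norm p \<le> r"
    using superlevel_bound[of "norm q"] by auto
  have "0 \<le> r" using r[of 0] by simp
  have "\<exists>p\<in>cball 0 r. \<forall>p'\<in>cball 0 r. p' \<bullet> q - H p' \<le> p \<bullet> q - H p"
    using \<open>0 \<le> r\<close> cont_H
    by (intro continuous_attains_sup) (auto intro!: continuous_intros intro: continuous_on_subset)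
  then obtain p where p: "norm p \<le> r" "\<And>p'. norm p' \<le> r \<Longrightarrow> p' \<bullet> q - H p' \<le> p \<bullet> q - H p"
    by auto
  have "p' \<bullet> q - H p' \<le> p \<bullet> q - H p" for p'
    using p(2)[of p'] p(2)[of 0] r[of p'] \<open>0 \<le> r\<close> by fastforce
  then show ?thesis by blast
qed

text \<open>
  The maximizer in the Legendre transform. It is the gradient of \<open>legendre H\<close> and the inverse of
  \<open>grad H\<close>.
\<close>

definition dual :: "real^'d \<Rightarrow> real^'d" where
  "dual q = (SOME p. \<forall>p'. p' \<bullet> q - H p' \<le> p \<bullet> q - H p)"

lemma dual_max: "p \<bullet> q - H p \<le> dual q \<bullet> q - H (dual q)"
  using someI_ex[OF legendre_attained[of q]] unfolding dual_def by blast

lemma legendre_eq: "legendre H q = dual q \<bullet> q - H (dual q)"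
  unfolding legendre_def
  by (rule antisym) (auto intro!: cSUP_least cSUP_upper dual_max bdd_aboveI2)

lemma legendre_ge: "p \<bullet> q - H p \<le> legendre H q"
  using dual_max by (simp add: legendre_eq)

lemma grad_dual: "grad H (dual q) = q"
proof -
  have "((\<lambda>p. p \<bullet> q - H p) has_derivative (\<lambda>h. h \<bullet> q - grad H (dual q) \<bullet> h)) (at (dual q))"
    by (intro derivative_intros H_deriv)
  then have "(\<lambda>h. h \<bullet> q - grad H (dual q) \<bullet> h) = (\<lambda>h. 0)"
    using dual_max by (intro differential_zero_maxmin[OF UNIV_I open_UNIV]) auto
  then have "(q - grad H (dual q)) \<bullet> (q - grad H (dual q)) = 0"
    by (auto simp: inner_diff_left inner_commute dest: fun_cong[where x = "q - grad H (dual q)"])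
  then show ?thesis by simp
qed

lemma dual_grad: "dual (grad H p) = p"
  using inj_grad_H grad_dual by (meson injD)

lemma dual_eq_iff: "dual p = dual q \<longleftrightarrow> p = q"
  by (metis grad_dual)

lemma dual_bounded: "\<exists>r>0. \<forall>q. norm q \<le> R \<longrightarrow> norm (dual q) \<le> r"
proof -
  obtain r where "\<And>p q. norm q \<le> R \<Longrightarrow> 0 \<bullet> q - H 0 \<le> p \<bullet> q - H p \<Longrightarrow> norm p \<le> r"
    using superlevel_bound[of R] by blast
  then have "\<And>q. norm q \<le> R \<Longrightarrow> norm (dual q) \<le> max r 1"
    using dual_max by (meson max.coboundedI1)
  then show ?thesis by (intro exI[of _ "max r 1"]) auto
qed

text \<open>Locally, \<open>dual\<close> is the inverse of a continuous injection of a compact ball.\<close>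

lemma continuous_dual: "continuous_on S dual"
proof -
  have "isCont dual q" for q
  proof -
    obtain r where r: "\<And>q'. norm q' \<le> norm q + 1 \<Longrightarrow> norm (dual q') \<le> r"
      using dual_bounded by blast
    have "continuous_on (grad H ` cball 0 r) dual"
      by (intro continuous_on_inv cont_grad_H) (auto simp: dual_grad)
    moreover have "ball 0 (norm q + 1) \<subseteq> grad H ` cball 0 r"
    proof
      fix q' :: "real^'d" assume "q' \<in> ball 0 (norm q + 1)"
      then have "dual q' \<in> cball 0 r" using r[of q'] by simp
      then show "q' \<in> grad H ` cball 0 r" using grad_dual[of q'] by (metis imageI)
    qed
    ultimately have "continuous_on (ball 0 (norm q + 1)) dual"
      using continuous_on_subset by blast
    then show ?thesis
      by (rule continuous_on_interior) auto
  qed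
  then show ?thesis by (simp add: continuous_at_imp_continuous_on)
qed

lemma legendre_deriv: "(legendre H has_derivative (\<lambda>h. dual q \<bullet> h)) (at q)"
proof -
  have bound: "norm (legendre H q' - legendre H q - dual q \<bullet> (q' - q)) \<le> norm (dual q' - dual q) * norm (q' - q)" for q'
  proof -
    have "0 \<le> legendre H q' - legendre H q - dual q \<bullet> (q' - q)"
      using legendre_ge[of "dual q" q'] by (simp add: legendre_eq[of q] inner_diff_right)
    moreover have "legendre H q' - legendre H q - dual q \<bullet> (q' - q) \<le> (dual q' - dual q) \<bullet> (q' - q)"
      using legendre_ge[of "dual q'" q] by (simp add: legendre_eq[of q'] inner_diff_right inner_diff_left)
    ultimately show ?thesis
      using norm_cauchy_schwarz[of "dual q' - dual q" "q' - q"] by simp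
  qed
  have "((\<lambda>q'. norm (dual q' - dual q)) \<longlongrightarrow> norm (dual q - dual q)) (at q)"
    using continuous_dual[of UNIV] by (intro tendsto_intros) (simp add: continuous_on_def)
  then have lim: "((\<lambda>q'. norm (dual q' - dual q)) \<longlongrightarrow> 0) (at q)" by simp
  have "((\<lambda>q'. (legendre H q' - legendre H q - dual q \<bullet> (q' - q)) /\<^sub>R norm (q' - q)) \<longlongrightarrow> 0) (at q)"
  proof (rule Lim_null_comparison[OF _ lim], rule always_eventually, rule allI)
    fix q'
    show "norm ((legendre H q' - legendre H q - dual q \<bullet> (q' - q)) /\<^sub>R norm (q' - q)) \<le> norm (dual q' - dual q)"
      using bound[of q'] by (cases "q' = q") (auto simp: field_simps)
  qed
  then show ?thesis
    by (simp add: has_derivative_at_within bounded_linear_inner_right)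
qed

lemma continuous_legendre: "continuous_on S (legendre H)"
  using legendre_deriv by (meson continuous_at_imp_continuous_on has_derivative_continuous)

lemma legendre_superlinear:
  assumes "0 \<le> K"
  shows "\<exists>C. \<forall>q. K * norm q - C \<le> legendre H q"
proof -
  have "\<exists>x\<in>cball 0 K. \<forall>y\<in>cball 0 K. H y \<le> H x"
    using cont_H assms by (intro continuous_attains_sup) (auto intro: continuous_on_subset)
  then obtain C where C: "\<And>p. norm p \<le> K \<Longrightarrow> H p \<le> C" by fastforce
  have "K * norm q - C \<le> legendre H q" for q
  proof -
    have "norm (K *\<^sub>R sgn q) \<le> K" using assms by (simp add: norm_sgn)
    moreover have "(K *\<^sub>R sgn q) \<bullet> q = K * norm q"
      by (cases "q = 0") (simp_all add: sgn_div_norm dot_square_norm power2_eq_square)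
    ultimately show ?thesis
      using legendre_ge[of "K *\<^sub>R sgn q" q] C[of "K *\<^sub>R sgn q"] by linarith
  qed
  then show ?thesis by blast
qed

text \<open>
  The speed bound: velocities whose cost exceeds that of standing still by at most one unit, after
  the largest possible gain of the initial datum, are bounded in terms of \<open>M\<close> and \<open>H\<close> only.
\<close>

lemma speed_bound:
  assumes "0 \<le> M"
  shows "\<exists>R>0. \<forall>q. legendre H q \<le> M * norm q + legendre H 0 + 1 \<longrightarrow> norm q \<le> R"
proof -
  obtain C where C: "\<And>q. (M + 1) * norm q - C \<le> legendre H q"
    using legendre_superlinear[of "M + 1"] assms by auto
  have "norm q \<le> max 1 (C + legendre H 0 + 1)" if "legendre H q \<le> M * norm q + legendre H 0 + 1" for q
    using C[of q] that by (simp add: algebra_simps)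
  then show ?thesis by (intro exI[of _ "max 1 (C + legendre H 0 + 1)"]) auto
qed

end

section \<open>Integration of compactly supported functions\<close>

lemma has_derivative_zero_off_closed:
  fixes f :: "'a::real_normed_vector \<Rightarrow> 'b::real_normed_vector"
  assumes "(f has_derivative f') (at x)" "closed S" "x \<notin> S" "\<And>y. y \<notin> S \<Longrightarrow> f y = 0"
  shows "f' = (\<lambda>_. 0)"
proof -
  have "((\<lambda>_. 0::'b) has_derivative f') (at x)"
    by (rule has_derivative_transform_within_open[OF assms(1), of "- S"]) (use assms in auto)
  then show ?thesis
    using has_derivative_unique has_derivative_const by blast
qed

lemma integrable_continuous_compact_support:
  fixes f :: "'a::euclidean_space \<Rightarrow> 'b::{banach, second_countable_topology}"
  assumes "continuous_on UNIV f" "compact S" "\<And>x. x \<notin> S \<Longrightarrow> f x = 0"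
  shows "integrable lborel f"
proof -
  have "integrable lborel (\<lambda>x. indicator S x *\<^sub>R f x)"
    using assms by (intro borel_integrable_compact) (auto intro: continuous_on_subset)
  moreover have "(\<lambda>x. indicator S x *\<^sub>R f x) = f"
    using assms(3) by (auto simp: indicator_def)
  ultimately show ?thesis by simp
qed

lemma lborel_integral_translation:
  fixes f :: "'a::euclidean_space \<Rightarrow> 'b::{banach, second_countable_topology}"
  assumes "f \<in> borel_measurable borel"
  shows "(LINT x|lborel. f (a + x)) = (LINT x|lborel. f x)"
proof -
  have "(LINT x|lborel. f x) = (LINT x|distr lborel borel ((+) a). f x)"
    by (simp add: lborel_distr_plus)
  also have "\<dots> = (LINT x|lborel. f (a + x))"
    using assms by (intro integral_distr) auto
  finally show ?thesis by simp
qed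

text \<open>
  The divergence theorem in the only case needed: difference quotients have integral zero by the
  translation invariance of Lebesgue measure, and they converge boundedly to the derivative.
\<close>

lemma integral_derivative_compact_support:
  fixes F :: "'a::euclidean_space \<Rightarrow> real"
  assumes F: "\<And>x. (F has_derivative F' x) (at x)"
    and cont: "continuous_on UNIV (\<lambda>x. F' x e)"
    and supp: "\<And>x. x \<notin> cball 0 \<rho> \<Longrightarrow> F x = 0"
  shows "(LINT x|lborel. F' x e) = 0"
proof -
  define s where "s n = 1 / real (Suc n)" for n
  have s: "0 < s n" "s n \<le> 1" for n by (auto simp: s_def)
  have s_lim: "s \<longlonglongrightarrow> 0" unfolding s_def by (rule LIMSEQ_Suc[OF lim_1_over_n])
  define D where "D n x = (F (s n *\<^sub>R e + x) - F x) / s n" for n x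
  define K where "K = cball (0::'a) (\<rho> + norm e)"
  have contF: "continuous_on UNIV F"
    using F by (meson continuous_at_imp_continuous_on has_derivative_continuous)
  have [measurable]: "F \<in> borel_measurable borel"
    using contF by (rule borel_measurable_continuous_onI)
  have line: "((\<lambda>r. F (r *\<^sub>R e + x)) has_field_derivative F' (r *\<^sub>R e + x) e) (at r)" for x r
  proof -
    have "((\<lambda>r. F (r *\<^sub>R e + x)) has_derivative (\<lambda>h. F' (r *\<^sub>R e + x) (h *\<^sub>R e))) (at r)"
      by (rule has_derivative_compose[where g = F, OF _ F]) (auto intro!: derivative_eq_intros)
    then show ?thesis
      using linear_cmul[OF has_derivative_linear[OF F]]
      by (simp add: has_field_derivative_def mult_commute_abs)
  qed
  obtain B where B: "\<And>x. x \<in> cball 0 (\<rho> + 2 * norm e) \<Longrightarrow> \<bar>F' x e\<bar> \<le> B"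
  proof -
    have "compact ((\<lambda>x. F' x e) ` cball 0 (\<rho> + 2 * norm e))"
      using cont by (intro compact_continuous_image) (auto intro: continuous_on_subset)
    then show ?thesis using that unfolding compact_eq_bounded_closed bounded_iff by (metis imageI real_norm_def)
  qed
  have D_bound: "norm (D n x) \<le> indicator K x * B" for n x
  proof (cases "x \<in> K")
    case True
    obtain z where z: "0 < z" "z < s n" "F (s n *\<^sub>R e + x) - F (0 *\<^sub>R e + x) = (s n - 0) * F' (z *\<^sub>R e + x) e"
      using MVT2[of 0 "s n" "\<lambda>r. F (r *\<^sub>R e + x)" "\<lambda>r. F' (r *\<^sub>R e + x) e"] line s(1) by blast
    have "z * norm e \<le> 1 * norm e" using z s(2)[of n] by (intro mult_right_mono) auto
    moreover have "norm (z *\<^sub>R e + x) \<le> norm (z *\<^sub>R e) + norm x" by (rule norm_triangle_ineq)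
    ultimately have "norm (z *\<^sub>R e + x) \<le> \<rho> + 2 * norm e"
      using True z by (simp add: K_def)
    then have "\<bar>F' (z *\<^sub>R e + x) e\<bar> \<le> B" by (intro B) simp
    then show ?thesis using z s[of n] True by (simp add: D_def)
  next
    case False
    have "norm x \<le> norm (s n *\<^sub>R e + x) + norm (s n *\<^sub>R e)"
      by (metis add_diff_cancel_left' norm_triangle_ineq4 add.commute)
    moreover have "s n * norm e \<le> 1 * norm e" using s[of n] by (intro mult_right_mono) auto
    moreover have "\<rho> + norm e < norm x" "norm (s n *\<^sub>R e) = s n * norm e"
      using False s[of n] by (auto simp: K_def)
    ultimately have "\<rho> < norm (s n *\<^sub>R e + x)" "\<rho> < norm x"
      using norm_ge_zero[of e] by linarith+
    then show ?thesis using supp by (simp add: D_def False)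
  qed
  have D_lim: "(\<lambda>n. D n x) \<longlonglongrightarrow> F' x e" for x
  proof -
    have "((\<lambda>h. (F (h *\<^sub>R e + x) - F x) / h) \<longlongrightarrow> F' x e) (at 0)"
      using line[of x 0] by (simp add: has_field_derivative_iff)
    then have "((\<lambda>n. (F (s n *\<^sub>R e + x) - F x) / s n) \<longlonglongrightarrow> F' x e)"
      by (rule filterlim_compose) (use s s_lim in \<open>auto simp: filterlim_at less_imp_neq[THEN not_sym]\<close>)
    then show ?thesis by (simp add: D_def)
  qed
  have "(\<lambda>n. LINT x|lborel. D n x) \<longlonglongrightarrow> (LINT x|lborel. F' x e)"
  proof (rule integral_dominated_convergence[where w = "\<lambda>x. indicator K x * B"])
    show "(\<lambda>x. F' x e) \<in> borel_measurable lborel"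
      using borel_measurable_continuous_onI[OF cont] by simp
    show "D n \<in> borel_measurable lborel" for n unfolding D_def by measurable
    have "integrable lborel (\<lambda>x. indicator K x *\<^sub>R B)"
      by (rule borel_integrable_compact) (auto simp: K_def)
    then show "integrable lborel (\<lambda>x. indicator K x * B)" by simp
  qed (use D_bound D_lim in auto)
  moreover have "(LINT x|lborel. D n x) = 0" for n
  proof -
    have i: "integrable lborel F"
      by (rule integrable_continuous_compact_support[OF contF, of "cball 0 \<rho>"]) (use supp in auto)
    have "continuous_on UNIV (\<lambda>x. F (s n *\<^sub>R e + x))"
      by (intro continuous_on_compose2[OF contF] continuous_intros) auto
    moreover have "F (s n *\<^sub>R e + x) = 0" if "x \<notin> cball (- (s n *\<^sub>R e)) \<rho>" for x
      using that norm_minus_cancel[of "s n *\<^sub>R e + x"] by (intro supp) (simp add: dist_norm)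
    ultimately have i': "integrable lborel (\<lambda>x. F (s n *\<^sub>R e + x))"
      by (intro integrable_continuous_compact_support[of _ "cball (- (s n *\<^sub>R e)) \<rho>"]) auto
    show ?thesis
      unfolding D_def using i i' lborel_integral_translation[of F "s n *\<^sub>R e"] by simp
  qed
  ultimately have "(\<lambda>n. 0::real) \<longlonglongrightarrow> (LINT x|lborel. F' x e)" by simp
  then show ?thesis using LIMSEQ_unique tendsto_const by blast
qed

lemma integral_by_parts_compact_support:
  fixes u v :: "'a::euclidean_space \<Rightarrow> real"
  assumes u: "\<And>x. (u has_derivative u' x) (at x)" "continuous_on UNIV (\<lambda>x. u' x e)"
    and v: "\<And>x. (v has_derivative v' x) (at x)" "continuous_on UNIV (\<lambda>x. v' x e)"
    and supp: "\<And>x. x \<notin> cball 0 \<rho> \<Longrightarrow> v x = 0"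
  shows "(LINT x|lborel. u x * v' x e) = - (LINT x|lborel. u' x e * v x)"
proof -
  have cu: "continuous_on UNIV u" and cv: "continuous_on UNIV v"
    using u(1) v(1) by (meson continuous_at_imp_continuous_on has_derivative_continuous)+
  have v'0: "v' x e = 0" if "x \<notin> cball 0 \<rho>" for x
    using has_derivative_zero_off_closed[OF v(1) closed_cball that supp] by simp
  have i1: "integrable lborel (\<lambda>x. u x * v' x e)"
    by (rule integrable_continuous_compact_support[of _ "cball 0 \<rho>"])
       (use v'0 cu v(2) in \<open>auto intro!: continuous_on_mult\<close>)
  have i2: "integrable lborel (\<lambda>x. u' x e * v x)"
    by (rule integrable_continuous_compact_support[of _ "cball 0 \<rho>"])
       (use supp cv u(2) in \<open>auto intro!: continuous_on_mult\<close>)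
  have "(LINT x|lborel. u x * v' x e + u' x e * v x) = 0"
  proof (rule integral_derivative_compact_support[where F = "\<lambda>x. u x * v x" and \<rho> = \<rho>
        and F' = "\<lambda>x h. u x * v' x h + u' x h * v x"])
    show "((\<lambda>x. u x * v x) has_derivative (\<lambda>h. u x * v' x h + u' x h * v x)) (at x)" for x
      by (rule has_derivative_mult[OF u(1) v(1)])
    show "continuous_on UNIV (\<lambda>x. u x * v' x e + u' x e * v x)"
      by (intro continuous_intros cu cv u(2) v(2))
  qed (use supp in auto)
  with i1 i2 show ?thesis by simp
qed

text \<open>
  No choice of coordinates is needed: the measure of the translates \<open>N - s e\<close> does not depend on \<open>s\<close>,
  and Fubini's theorem computes its average over \<open>s \<in> [0, 1]\<close>.
\<close>

lemma null_set_countable_lines: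
  fixes N :: "'a::euclidean_space set"
  assumes [measurable]: "N \<in> sets borel" and lines: "\<And>x. countable {s::real. s *\<^sub>R e + x \<in> N}"
  shows "N \<in> null_sets lborel"
proof -
  let ?I = "{0..1::real}"
  have slice: "(\<integral>\<^sup>+ x. indicator N (s *\<^sub>R e + x) \<partial>lborel) = emeasure lborel N" for s
  proof -
    have "(\<integral>\<^sup>+ x. indicator N (s *\<^sub>R e + x) \<partial>lborel) = (\<integral>\<^sup>+ x. indicator N x \<partial>distr lborel borel ((+) (s *\<^sub>R e)))"
      by (subst nn_integral_distr) auto
    then show ?thesis by (simp add: lborel_distr_plus)
  qed
  have "emeasure lborel N = (\<integral>\<^sup>+ s. emeasure lborel N * indicator ?I s \<partial>lborel)"
    by (subst nn_integral_cmult_indicator) auto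
  also have "\<dots> = (\<integral>\<^sup>+ s. (\<integral>\<^sup>+ x. indicator N (s *\<^sub>R e + x) * indicator ?I s \<partial>lborel) \<partial>lborel)"
    by (subst nn_integral_multc) (auto simp: slice)
  also have "\<dots> = (\<integral>\<^sup>+ x. (\<integral>\<^sup>+ s. indicator N (s *\<^sub>R e + x) * indicator ?I s \<partial>lborel) \<partial>lborel)"
    by (rule lborel_pair.Fubini') measurable
  also have "\<dots> = (\<integral>\<^sup>+ (x::'a). 0 \<partial>lborel)"
  proof (rule nn_integral_cong)
    fix x
    have "{s::real. s *\<^sub>R e + x \<in> N} \<in> null_sets lborel"
      by (rule countable_imp_null_set_lborel[OF lines])
    then have "AE s in lborel. s \<notin> {s::real. s *\<^sub>R e + x \<in> N}" by (rule AE_not_in)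
    then have "AE s in lborel. indicator N (s *\<^sub>R e + x) * indicator ?I s = (0::ennreal)"
      by eventually_elim (auto simp: indicator_def)
    then show "(\<integral>\<^sup>+ s. indicator N (s *\<^sub>R e + x) * indicator ?I s \<partial>lborel) = 0"
      by (subst nn_integral_0_iff_AE) auto
  qed
  finally show ?thesis by (simp add: null_setsI)
qed

section \<open>Elementary smooth cutoffs\<close>

text \<open>The function \<open>s \<mapsto> (max 0 s)\<^sup>2\<close> is the elementary continuously differentiable building block.\<close>

definition sq_pos :: "real \<Rightarrow> real" where
  "sq_pos s = (max 0 s)\<^sup>2"

lemma sq_pos_deriv: "(sq_pos has_field_derivative 2 * max 0 s) (at s)"
proof -
  consider "s < 0" | "s = 0" | "s > 0" by linarith
  then show ?thesis
  proof cases
    case 1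
    have "(sq_pos has_field_derivative 0) (at s)"
      by (rule has_field_derivative_transform_within_open[of "\<lambda>_. 0" _ _ "{..<0}"])
         (use 1 in \<open>auto simp: sq_pos_def\<close>)
    then show ?thesis using 1 by simp
  next
    case 3
    have "(sq_pos has_field_derivative 2 * s) (at s)"
      by (rule has_field_derivative_transform_within_open[of "\<lambda>s. s\<^sup>2" _ _ "{0<..}"])
         (use 3 in \<open>auto simp: sq_pos_def intro!: derivative_eq_intros\<close>)
    then show ?thesis using 3 by simp
  next
    case 2
    have "((\<lambda>h. sq_pos h / h) \<longlongrightarrow> 0) (at 0)"
    proof (rule Lim_null_comparison)
      show "\<forall>\<^sub>F h in at 0. norm (sq_pos h / h) \<le> \<bar>h\<bar>"
        by (auto simp: sq_pos_def power2_eq_square max_def)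
      show "((\<lambda>h::real. \<bar>h\<bar>) \<longlongrightarrow> 0) (at 0)"
        by (auto intro!: tendsto_eq_intros)
    qed
    then show ?thesis using 2 by (simp add: has_field_derivative_iff sq_pos_def)
  qed
qed

lemma sq_pos_bounds: "0 \<le> sq_pos s" "s \<le> 0 \<Longrightarrow> sq_pos s = 0" "1 \<le> s \<Longrightarrow> 1 \<le> sq_pos s" "s \<le> 1 \<Longrightarrow> sq_pos s \<le> 1"
  by (auto simp: sq_pos_def max_def power2_eq_square intro: mult_le_one mult_ge1_I)

text \<open>
  For \<open>r > 0\<close>, a function that is at least \<open>1\<close> on the ball of radius \<open>r\<close> about \<open>c\<close> and vanishes off the
  ball of radius \<open>2 r\<close>, together with its gradient.
\<close>

definition bump :: "'a::real_inner \<Rightarrow> real \<Rightarrow> 'a \<Rightarrow> real" where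
  "bump c r x = sq_pos (2 - (norm (x - c))\<^sup>2 / r\<^sup>2)"

definition bump_grad :: "'a::real_inner \<Rightarrow> real \<Rightarrow> 'a \<Rightarrow> 'a" where
  "bump_grad c r x = (- (4 * max 0 (2 - (norm (x - c))\<^sup>2 / r\<^sup>2) / r\<^sup>2)) *\<^sub>R (x - c)"

lemma bump_deriv: "(bump c r has_derivative (\<lambda>h. bump_grad c r x \<bullet> h)) (at x)"
proof -
  have "((\<lambda>x. 2 - (norm (x - c))\<^sup>2 / r\<^sup>2) has_derivative (\<lambda>h. - (2 * ((x - c) \<bullet> h)) / r\<^sup>2)) (at x)"
    unfolding power2_norm_eq_inner
    by (auto intro!: derivative_eq_intros simp: inner_commute divide_inverse algebra_simps)
  from has_derivative_compose[OF this sq_pos_deriv[unfolded has_field_derivative_def]]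
  show ?thesis
    unfolding bump_def[abs_def] bump_grad_def
    by (rule has_derivative_eq_rhs) (simp add: fun_eq_iff divide_inverse mult_ac)
qed

lemma continuous_bump_grad: "continuous_on S (bump_grad c r)"
  unfolding bump_grad_def[abs_def] divide_inverse by (intro continuous_intros)

lemma bump_nonneg: "0 \<le> bump c r x"
  by (simp add: bump_def sq_pos_bounds)

lemma bump_ge_1: "norm (x - c) \<le> r \<Longrightarrow> 0 < r \<Longrightarrow> 1 \<le> bump c r x"
  unfolding bump_def by (intro sq_pos_bounds) (simp add: field_simps power_mono)

lemma bump_arg_neg:
  assumes "2 * r \<le> norm (x - c)" "0 < r"
  shows "2 - (norm (x - c))\<^sup>2 / r\<^sup>2 \<le> 0"
proof -
  have "(2 * r)\<^sup>2 \<le> (norm (x - c))\<^sup>2" using assms by (intro power_mono) auto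
  moreover have "2 * r\<^sup>2 \<le> (2 * r)\<^sup>2" by (simp add: power2_eq_square)
  ultimately have "2 * r\<^sup>2 \<le> (norm (x - c))\<^sup>2" by linarith
  then show ?thesis using assms by (simp add: field_simps)
qed

lemma bump_eq_0: "2 * r \<le> norm (x - c) \<Longrightarrow> 0 < r \<Longrightarrow> bump c r x = 0"
  unfolding bump_def by (intro sq_pos_bounds bump_arg_neg)

lemma norm_bump_grad:
  assumes "0 < r"
  shows "norm (bump_grad c r x) \<le> indicator (cball c (2 * r)) x * (16 / r)"
proof (cases "2 * r < norm (x - c)")
  case True
  then show ?thesis
    using bump_arg_neg[of r x c] assms by (simp add: bump_grad_def dist_norm norm_minus_commute)
next
  case False
  have "norm (bump_grad c r x) = 4 * max 0 (2 - (norm (x - c))\<^sup>2 / r\<^sup>2) / r\<^sup>2 * norm (x - c)"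
    by (simp add: bump_grad_def)
  also have "\<dots> \<le> 4 * 2 / r\<^sup>2 * (2 * r)"
    using False assms by (intro mult_mono divide_right_mono) auto
  also have "\<dots> = 16 / r" using assms by (simp add: power2_eq_square)
  finally show ?thesis using False by (simp add: dist_norm norm_minus_commute)
qed

section \<open>Almost everywhere uniqueness of Hopf-Lax minimizers\<close>

text \<open>
  If the upper right slope of \<open>g\<close> at \<open>s\<close> lies below its lower left slope, then for a rational \<open>c\<close> between
  the two, \<open>s\<close> is the only maximum point of \<open>s' \<mapsto> g s' - c s'\<close> in an interval with rational endpoints.
\<close>

lemma countable_corners:
  fixes g :: "real \<Rightarrow> real"
  assumes "\<And>s. s \<in> S \<Longrightarrow> \<exists>l m \<delta>. l < m \<and> 0 < \<delta> \<and>
    (\<forall>h. 0 < h \<longrightarrow> h < \<delta> \<longrightarrow> g (s + h) \<le> g s + l * h \<and> g (s - h) \<le> g s - m * h)"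
  shows "countable S"
proof -
  define A where "A = (\<lambda>(c, a, b). {s. a < s \<and> s < b \<and> (\<forall>s'. a < s' \<longrightarrow> s' < b \<longrightarrow> s' \<noteq> s \<longrightarrow> g s' - c * s' < g s - c * s)})"
  have "countable (A z)" for z
  proof -
    obtain c a b where z: "z = (c, a, b)" by (cases z) auto
    have "s = s'" if "s \<in> A z" "s' \<in> A z" for s s'
      using that unfolding z A_def by (auto intro: ccontr) (smt (verit))
    then have "A z \<subseteq> {s}" if "s \<in> A z" for s using that by blast
    then show ?thesis by (metis countable_empty countable_insert countable_subset all_not_in_conv)
  qed
  moreover have "S \<subseteq> (\<Union>z \<in> \<rat> \<times> \<rat> \<times> \<rat>. A z)"
  proof
    fix s assume "s \<in> S"
    from assms[OF this] obtain l m \<delta> where lm: "l < m" "0 < \<delta>"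
      and g: "\<And>h. 0 < h \<Longrightarrow> h < \<delta> \<Longrightarrow> g (s + h) \<le> g s + l * h"
        "\<And>h. 0 < h \<Longrightarrow> h < \<delta> \<Longrightarrow> g (s - h) \<le> g s - m * h" by blast
    obtain c where c: "c \<in> \<rat>" "l < c" "c < m" using Rats_dense_in_real[OF lm(1)] by blast
    obtain a where a: "a \<in> \<rat>" "s - \<delta> < a" "a < s" using Rats_dense_in_real[of "s - \<delta>" s] lm by auto
    obtain b where b: "b \<in> \<rat>" "s < b" "b < s + \<delta>" using Rats_dense_in_real[of s "s + \<delta>"] lm by auto
    have "g s' - c * s' < g s - c * s" if "a < s'" "s' < b" "s' \<noteq> s" for s'
    proof (cases "s < s'")
      case True
      have "g s' \<le> g s + l * (s' - s)" using g(1)[of "s' - s"] True that b by simp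
      moreover have "l * (s' - s) < c * (s' - s)" using c True by simp
      ultimately show ?thesis by (simp add: algebra_simps)
    next
      case False
      have "g s' \<le> g s - m * (s - s')" using g(2)[of "s - s'"] False that a by simp
      moreover have "c * (s - s') < m * (s - s')" using c False that by simp
      ultimately show ?thesis by (simp add: algebra_simps)
    qed
    then have "s \<in> A (c, a, b)" using a b by (simp add: A_def)
    then show "s \<in> (\<Union>z \<in> \<rat> \<times> \<rat> \<times> \<rat>. A z)" using a b c by blast
  qed
  ultimately show ?thesis
    by (meson countable_SIGMA countable_UN countable_rat countable_subset)
qed

text \<open>
  The numbers \<open>R\<close> and \<open>r\<close> bound the speeds of nearly optimal rays and the corresponding slopes; they
  can be chosen in terms of \<open>M\<close> and \<open>H\<close> alone.
\<close>

locale hopf_lax = hamiltonian H for H :: "real^'d \<Rightarrow> real" +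
  fixes u0 :: "real^'d \<Rightarrow> real" and M t R r :: real
  assumes lipschitz: "M-lipschitz_on UNIV u0" and t_pos: "0 < t" and R_pos: "0 < R"
    and R: "\<And>q. legendre H q \<le> M * norm q + legendre H 0 + 1 \<Longrightarrow> norm q \<le> R"
    and r_pos: "0 < r" and r: "\<And>q. norm q \<le> R \<Longrightarrow> norm (dual q) \<le> r"
begin

text \<open>The function minimized over \<open>y\<close> in the Hopf-Lax formula at the point \<open>x\<close>.\<close>

definition cost :: "real^'d \<Rightarrow> real^'d \<Rightarrow> real" where
  "cost x y = u0 y + t * legendre H ((x - y) /\<^sub>R t)"

definition is_min :: "real^'d \<Rightarrow> real^'d \<Rightarrow> bool" where
  "is_min x y \<longleftrightarrow> (\<forall>z. cost x y \<le> cost x z)"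

lemma minimizers_eq: "hopf_lax_minimizers H u0 t x = {y. is_min x y}"
  by (auto simp: hopf_lax_minimizers_def is_arg_min_linorder cost_def is_min_def)

lemma continuous_cost [continuous_intros]:
  assumes "continuous_on S f" "continuous_on S g"
  shows "continuous_on S (\<lambda>z. cost (f z) (g z))"
proof -
  have "continuous_on UNIV u0"
    using lipschitz by (rule lipschitz_on_continuous_on)
  then show ?thesis
    unfolding cost_def using assms
    by (auto intro!: continuous_intros continuous_on_compose2[OF continuous_legendre[of UNIV]]
      continuous_on_compose2[of UNIV u0])
qed

lemma continuous_dual_comp [continuous_intros]:
  "continuous_on S f \<Longrightarrow> continuous_on S (\<lambda>z. dual (f z))"
  by (rule continuous_on_compose2[OF continuous_dual[of UNIV]]) auto

lemma cost_deriv: "((\<lambda>x. cost x y) has_derivative (\<lambda>h. dual ((x - y) /\<^sub>R t) \<bullet> h)) (at x)"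
proof -
  have "((\<lambda>x. legendre H ((x - y) /\<^sub>R t)) has_derivative (\<lambda>h. dual ((x - y) /\<^sub>R t) \<bullet> (h /\<^sub>R t))) (at x)"
    by (rule has_derivative_compose[OF _ legendre_deriv]) (auto intro!: derivative_eq_intros)
  then have "((\<lambda>x. u0 y + t * legendre H ((x - y) /\<^sub>R t)) has_derivative
     (\<lambda>h. 0 + t * (dual ((x - y) /\<^sub>R t) \<bullet> (h /\<^sub>R t)))) (at x)"
    by (intro derivative_intros)
  moreover have "(\<lambda>h. 0 + t * (dual ((x - y) /\<^sub>R t) \<bullet> (h /\<^sub>R t))) = (\<lambda>h. dual ((x - y) /\<^sub>R t) \<bullet> h)"
    using t_pos by (simp add: fun_eq_iff mult.assoc[symmetric])
  ultimately show ?thesis unfolding cost_def by simp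
qed

text \<open>
  The competitor \<open>y = x\<close> costs \<open>u0 x + t * legendre H 0\<close>. The slack \<open>t\<close> above it separates
  the competitors with speed at most \<open>R\<close> from those with negligible Gibbs weight below.
\<close>

lemma near_minimizer_speed:
  assumes "cost x y \<le> cost x x + t"
  shows "norm ((x - y) /\<^sub>R t) \<le> R"
proof (rule R)
  let ?q = "(x - y) /\<^sub>R t"
  have "u0 x - u0 y \<le> M * norm (x - y)"
    using lipschitz_onD[OF lipschitz, of x y] by (simp add: dist_norm)
  also have "norm (x - y) = t * norm ?q" using t_pos by simp
  finally have "t * legendre H ?q \<le> t * (M * norm ?q + legendre H 0 + 1)"
    using assms by (simp add: cost_def algebra_simps)
  then show "legendre H ?q \<le> M * norm ?q + legendre H 0 + 1"
    using t_pos by simp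
qed

lemma near_minimizer_dist:
  assumes "cost x y \<le> cost x x + t"
  shows "dist x y \<le> t * R"
proof -
  have "dist x y = t * norm ((x - y) /\<^sub>R t)" using t_pos by (simp add: dist_norm)
  also have "\<dots> \<le> t * R" using near_minimizer_speed[OF assms] t_pos by (intro mult_left_mono) auto
  finally show ?thesis .
qed

lemma min_is_near: "is_min x y \<Longrightarrow> cost x y \<le> cost x x + t"
  using t_pos by (meson add_increasing2 is_min_def less_imp_le)

lemma is_min_exists: "\<exists>y. is_min x y"
proof -
  have "0 < t * R" using t_pos R_pos by simp
  then have "\<exists>y\<in>cball x (t * R). \<forall>z\<in>cball x (t * R). cost x y \<le> cost x z"
    by (intro continuous_attains_inf continuous_intros) auto
  then obtain y where y: "\<And>z. dist x z \<le> t * R \<Longrightarrow> cost x y \<le> cost x z"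
    by (meson mem_cball)
  have "cost x y \<le> cost x z" for z
  proof (cases "dist x z \<le> t * R")
    case False
    then have "cost x x < cost x z" using near_minimizer_dist[of x z] t_pos by linarith
    then show ?thesis using y[of x] t_pos R_pos by simp
  qed (rule y)
  then show ?thesis by (auto simp: is_min_def)
qed

text \<open>The points that have two minimizers with slopes distinguished by the direction \<open>e\<close>.\<close>

definition ambiguous :: "real^'d \<Rightarrow> (real^'d) set" where
  "ambiguous e = {x. \<exists>y z. is_min x y \<and> is_min x z \<and> dual ((x - y) /\<^sub>R t) \<bullet> e < dual ((x - z) /\<^sub>R t) \<bullet> e}"

text \<open>The set is a countable union of projections of compact sets.\<close>

lemma ambiguous_borel: "ambiguous e \<in> sets borel"
proof -
  define C where "C n k = {(x, y, z). norm x \<le> real n \<and> is_min x y \<and> is_min x z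
     \<and> dual ((x - y) /\<^sub>R t) \<bullet> e + 1 / real (Suc k) \<le> dual ((x - z) /\<^sub>R t) \<bullet> e}" for n k
  have "ambiguous e = (\<Union>n k. fst ` C n k)"
  proof safe
    fix x assume "x \<in> ambiguous e"
    then obtain y z where yz: "is_min x y" "is_min x z" "dual ((x - y) /\<^sub>R t) \<bullet> e < dual ((x - z) /\<^sub>R t) \<bullet> e"
      by (auto simp: ambiguous_def)
    obtain k where "1 / real (Suc k) < dual ((x - z) /\<^sub>R t) \<bullet> e - dual ((x - y) /\<^sub>R t) \<bullet> e"
      using yz(3) by (metis diff_gt_0_iff_gt nat_approx_posE)
    moreover obtain n where "norm x \<le> real n" using real_arch_simple by blast
    ultimately have "(x, y, z) \<in> C n k" using yz by (simp add: C_def)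
    then show "x \<in> (\<Union>n k. fst ` C n k)" by force
  next
    fix n k x y z assume "(x, y, z) \<in> C n k"
    then have C: "is_min x y" "is_min x z" "dual ((x - y) /\<^sub>R t) \<bullet> e + 1 / real (Suc k) \<le> dual ((x - z) /\<^sub>R t) \<bullet> e"
      by (simp_all add: C_def)
    have "0 < 1 / real (Suc k)" by simp
    with C(3) have "dual ((x - y) /\<^sub>R t) \<bullet> e < dual ((x - z) /\<^sub>R t) \<bullet> e" by linarith
    with C show "fst (x, y, z) \<in> ambiguous e" by (auto simp: ambiguous_def)
  qed
  moreover have "compact (C n k)" for n k
  proof -
    have "closed (C n k)"
      unfolding C_def is_min_def split_def
      by (intro closed_Collect_conj closed_Collect_all closed_Collect_le continuous_intros)
    moreover have "C n k \<subseteq> cball 0 (real n) \<times> cball 0 (real n + t * R) \<times> cball 0 (real n + t * R)"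
    proof -
      have "norm y \<le> real n + t * R" if "norm x \<le> real n" "is_min x y" for x y
        using near_minimizer_dist[OF min_is_near[OF that(2)]] that(1) norm_triangle_sub[of y x]
        by (simp add: dist_norm norm_minus_commute)
      then show ?thesis by (auto simp: C_def)
    qed
    then have "bounded (C n k)" by (rule bounded_subset[rotated]) (intro bounded_Times bounded_cball)
    ultimately show ?thesis by (simp add: compact_eq_bounded_closed)
  qed
  then have "fst ` C n k \<in> sets borel" for n k
    by (intro borel_closed compact_imp_closed compact_continuous_image continuous_intros)
  ultimately show ?thesis by auto
qed

text \<open>
  Along a line in direction \<open>e\<close>, an ambiguous point is a concave corner of the value function,
  because the value function lies below the cost of each of its minimizers.
\<close>

lemma ambiguous_null: "ambiguous e \<in> null_sets lborel"
proof (rule null_set_countable_lines[OF ambiguous_borel, where e = e])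
  fix x
  define V where "V x' = (INF y. cost x' y)" for x'
  have V_le: "V x' \<le> cost x' y" for x' y
  proof -
    obtain m where "is_min x' m" using is_min_exists by blast
    then have "bdd_below (range (cost x'))" by (auto simp: is_min_def intro!: bdd_belowI2)
    then show ?thesis unfolding V_def by (rule cINF_lower) simp
  qed
  have V_eq: "V x' = cost x' y" if "is_min x' y" for x' y
    using that V_le unfolding V_def is_min_def by (intro antisym cINF_greatest) (auto simp: V_def[symmetric])
  have line: "((\<lambda>s. cost (s *\<^sub>R e + x) y) has_field_derivative dual ((s *\<^sub>R e + x - y) /\<^sub>R t) \<bullet> e) (at s)" for y s
  proof -
    have "((\<lambda>s. cost (s *\<^sub>R e + x) y) has_derivative (\<lambda>h. dual ((s *\<^sub>R e + x - y) /\<^sub>R t) \<bullet> (h *\<^sub>R e))) (at s)"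
      by (rule has_derivative_compose[OF _ cost_deriv]) (auto intro!: derivative_eq_intros)
    then show ?thesis by (simp add: has_field_derivative_def mult_commute_abs)
  qed
  show "countable {s. s *\<^sub>R e + x \<in> ambiguous e}"
  proof (rule countable_corners[where g = "\<lambda>s. V (s *\<^sub>R e + x)"])
    fix s assume "s \<in> {s. s *\<^sub>R e + x \<in> ambiguous e}"
    then obtain y z where yz: "is_min (s *\<^sub>R e + x) y" "is_min (s *\<^sub>R e + x) z"
      and less: "dual ((s *\<^sub>R e + x - y) /\<^sub>R t) \<bullet> e < dual ((s *\<^sub>R e + x - z) /\<^sub>R t) \<bullet> e"
      by (auto simp: ambiguous_def)
    obtain l where l: "dual ((s *\<^sub>R e + x - y) /\<^sub>R t) \<bullet> e < l" "l < dual ((s *\<^sub>R e + x - z) /\<^sub>R t) \<bullet> e"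
      using dense[OF less] by blast
    obtain m where m: "l < m" "m < dual ((s *\<^sub>R e + x - z) /\<^sub>R t) \<bullet> e"
      using dense[OF l(2)] by blast
    have "((\<lambda>r. cost (r *\<^sub>R e + x) y - l * r) has_field_derivative (dual ((s *\<^sub>R e + x - y) /\<^sub>R t) \<bullet> e - l)) (at s)"
      by (auto intro!: derivative_eq_intros line)
    from DERIV_neg_dec_right[OF this] l(1)
    obtain d1 where d1: "d1 > 0" "\<And>h. 0 < h \<Longrightarrow> h < d1 \<Longrightarrow>
       cost ((s + h) *\<^sub>R e + x) y - l * (s + h) < cost (s *\<^sub>R e + x) y - l * s" by auto
    have "((\<lambda>r. cost (r *\<^sub>R e + x) z - m * r) has_field_derivative (dual ((s *\<^sub>R e + x - z) /\<^sub>R t) \<bullet> e - m)) (at s)"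
      by (auto intro!: derivative_eq_intros line)
    from DERIV_pos_inc_left[OF this] m(2)
    obtain d2 where d2: "d2 > 0" "\<And>h. 0 < h \<Longrightarrow> h < d2 \<Longrightarrow>
       cost ((s - h) *\<^sub>R e + x) z - m * (s - h) < cost (s *\<^sub>R e + x) z - m * s" by auto
    have "V ((s + h) *\<^sub>R e + x) \<le> V (s *\<^sub>R e + x) + l * h \<and> V ((s - h) *\<^sub>R e + x) \<le> V (s *\<^sub>R e + x) - m * h"
      if "0 < h" "h < min d1 d2" for h
      using d1(2)[of h] d2(2)[of h] that V_le[of "(s + h) *\<^sub>R e + x" y] V_le[of "(s - h) *\<^sub>R e + x" z]
        V_eq[OF yz(1)] V_eq[OF yz(2)] by (simp add: algebra_simps)
    then show "\<exists>l m \<delta>. l < m \<and> 0 < \<delta> \<and> (\<forall>h. 0 < h \<longrightarrow> h < \<delta> \<longrightarrow>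
         V ((s + h) *\<^sub>R e + x) \<le> V (s *\<^sub>R e + x) + l * h \<and> V ((s - h) *\<^sub>R e + x) \<le> V (s *\<^sub>R e + x) - m * h)"
      using m(1) d1(1) d2(1) by (intro exI[of _ l] exI[of _ m] exI[of _ "min d1 d2"]) auto
  qed
qed

lemma AE_unique_minimizer: "AE x in lborel. \<exists>y. \<forall>z. is_min x z \<longleftrightarrow> z = y"
proof -
  have "AE x in lborel. \<forall>i. x \<notin> ambiguous (axis i 1)"
    using AE_not_in[OF ambiguous_null] by (simp add: AE_all_countable)
  then show ?thesis
  proof eventually_elim
    case (elim x)
    obtain y where y: "is_min x y" using is_min_exists by blast
    have "z = y" if z: "is_min x z" for z
    proof -
      have "dual ((x - y) /\<^sub>R t) $ i = dual ((x - z) /\<^sub>R t) $ i" for i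
      proof (rule ccontr)
        assume "dual ((x - y) /\<^sub>R t) $ i \<noteq> dual ((x - z) /\<^sub>R t) $ i"
        then have "x \<in> ambiguous (axis i 1)"
          using y z unfolding ambiguous_def by (auto simp: inner_axis neq_iff)
        then show False using elim by blast
      qed
      then have "dual ((x - y) /\<^sub>R t) = dual ((x - z) /\<^sub>R t)" by (simp add: vec_eq_iff)
      then show ?thesis using t_pos by (simp add: dual_eq_iff)
    qed
    then show ?case using y by blast
  qed
qed

lemma backward_slope_unique:
  assumes "\<forall>z. is_min x z \<longleftrightarrow> z = y"
  shows "x - t *\<^sub>R backward_slope H u0 t x = y"
proof -
  have "backward_slopes H u0 t x = {(x - y) /\<^sub>R t}"
    using assms by (auto simp: backward_slopes_def minimizers_eq)
  then show ?thesis using t_pos by (simp add: backward_slope_def)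
qed

lemma norm_backward_slope: "norm (backward_slope H u0 t x) \<le> R"
proof (cases "is_singleton (backward_slopes H u0 t x)")
  case True
  then obtain q where q: "backward_slopes H u0 t x = {q}" by (auto simp: is_singleton_def)
  then obtain y where "is_min x y" "q = (x - y) /\<^sub>R t"
    by (auto simp: backward_slopes_def minimizers_eq)
  then show ?thesis
    using near_minimizer_speed[OF min_is_near] q by (simp add: backward_slope_def)
qed (use R_pos in \<open>simp add: backward_slope_def\<close>)

end

section \<open>Regularized minimizers\<close>

text \<open>The covariance of \<open>a\<close> and \<open>f\<close> under the weights \<open>w\<close>, as a sum over pairs.\<close>

lemma weighted_covariance:
  fixes f :: "'i \<Rightarrow> 'a::real_vector"
  assumes "sum w Y = (1::real)"
  shows "(\<Sum>y\<in>Y. (w y * (a y - (\<Sum>z\<in>Y. w z * a z))) *\<^sub>R f y)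
    = (1/2) *\<^sub>R (\<Sum>y\<in>Y. \<Sum>z\<in>Y. (w y * w z * (a y - a z)) *\<^sub>R (f y - f z))"
proof -
  let ?T = "\<Sum>y\<in>Y. (w y * (a y - (\<Sum>z\<in>Y. w z * a z))) *\<^sub>R f y"
  have T: "(\<Sum>y\<in>Y. \<Sum>z\<in>Y. (w y * w z * (a y - a z)) *\<^sub>R f y) = ?T"
  proof (rule sum.cong[OF refl])
    fix y
    have "(\<Sum>z\<in>Y. w y * w z * (a y - a z)) = w y * ((\<Sum>z\<in>Y. w z) * a y - (\<Sum>z\<in>Y. w z * a z))"
      by (simp add: sum_distrib_left sum_distrib_right sum_subtractf algebra_simps)
    then show "(\<Sum>z\<in>Y. (w y * w z * (a y - a z)) *\<^sub>R f y) = (w y * (a y - (\<Sum>z\<in>Y. w z * a z))) *\<^sub>R f y"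
      using assms by (simp add: scaleR_left.sum[symmetric])
  qed
  have "(\<Sum>y\<in>Y. \<Sum>z\<in>Y. (w y * w z * (a y - a z)) *\<^sub>R f z) = (\<Sum>z\<in>Y. \<Sum>y\<in>Y. (w y * w z * (a y - a z)) *\<^sub>R f z)"
    by (rule sum.swap)
  also have "\<dots> = (\<Sum>z\<in>Y. \<Sum>y\<in>Y. - ((w z * w y * (a z - a y)) *\<^sub>R f z))"
    by (intro sum.cong refl) (simp add: algebra_simps flip: scaleR_minus_left)
  also have "\<dots> = - ?T" by (simp only: sum_negf T)
  finally have "(\<Sum>y\<in>Y. \<Sum>z\<in>Y. (w y * w z * (a y - a z)) *\<^sub>R (f y - f z)) = ?T + ?T"
    by (simp add: scaleR_diff_right sum_subtractf T)
  then show ?thesis by (simp flip: scaleR_2)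
qed

text \<open>The Cauchy-Schwarz inequality for the rank one matrix \<open>a \<otimes> v\<close>.\<close>

lemma contraction_le:
  fixes a :: "real^'m" and v :: "real^'n" and \<Phi> :: "real^'n^'m"
  shows "(\<Sum>\<alpha>\<in>UNIV. \<Sum>i\<in>UNIV. v $ i * a $ \<alpha> * \<Phi> $ \<alpha> $ i) \<le> norm v * norm a * norm \<Phi>"
proof -
  define T where "T = (\<chi> \<alpha>. a $ \<alpha> *\<^sub>R v)"
  have "T \<bullet> T = (\<Sum>\<alpha>\<in>UNIV. (a $ \<alpha> * a $ \<alpha>) * (v \<bullet> v))"
    by (simp add: T_def inner_vec_def[of T] inner_vec_def[of "\<chi> \<alpha>. a $ \<alpha> *\<^sub>R v"] mult.assoc)
  also have "\<dots> = (a \<bullet> a) * (v \<bullet> v)" by (simp add: inner_vec_def[of a a] sum_distrib_right)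
  finally have "norm T = norm v * norm a"
    by (simp add: norm_eq_sqrt_inner real_sqrt_mult mult.commute)
  moreover have "(\<Sum>\<alpha>\<in>UNIV. \<Sum>i\<in>UNIV. v $ i * a $ \<alpha> * \<Phi> $ \<alpha> $ i) = T \<bullet> \<Phi>"
    by (simp add: T_def inner_vec_def mult_ac)
  ultimately show ?thesis
    using norm_cauchy_schwarz[of T \<Phi>] by simp
qed

context hopf_lax
begin

text \<open>The gradient at \<open>x\<close> of the cost of the competitor \<open>y\<close>.\<close>

definition slope :: "real^'d \<Rightarrow> real^'d \<Rightarrow> real^'d" where
  "slope x y = dual ((x - y) /\<^sub>R t)"

text \<open>
  The Gibbs weights at inverse temperature \<open>\<beta>\<close> of a finite set \<open>Y\<close> of competitors, the resulting
  mean competitor, and its derivative.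
\<close>

definition weight :: "real \<Rightarrow> (real^'d) set \<Rightarrow> real^'d \<Rightarrow> real^'d \<Rightarrow> real" where
  "weight \<beta> Y x y = exp (- \<beta> * cost x y) / (\<Sum>z\<in>Y. exp (- \<beta> * cost x z))"

definition soft_min :: "real \<Rightarrow> (real^'d) set \<Rightarrow> real^'d \<Rightarrow> real^'d" where
  "soft_min \<beta> Y x = (\<Sum>y\<in>Y. weight \<beta> Y x y *\<^sub>R y)"

definition soft_min_deriv :: "real \<Rightarrow> (real^'d) set \<Rightarrow> real^'d \<Rightarrow> real^'d \<Rightarrow> real^'d" where
  "soft_min_deriv \<beta> Y x h = (\<beta> / 2) *\<^sub>R (\<Sum>y\<in>Y. \<Sum>z\<in>Y.
     (weight \<beta> Y x y * weight \<beta> Y x z * ((slope x y - slope x z) \<bullet> h)) *\<^sub>R (z - y))"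

lemma partition_pos: "finite Y \<Longrightarrow> Y \<noteq> {} \<Longrightarrow> 0 < (\<Sum>z\<in>Y. exp (- \<beta> * cost x z))"
  by (rule sum_pos) auto

lemma weight_nonneg: "0 \<le> weight \<beta> Y x y"
  unfolding weight_def by (intro divide_nonneg_nonneg sum_nonneg) auto

lemma sum_weight: "finite Y \<Longrightarrow> Y \<noteq> {} \<Longrightarrow> sum (weight \<beta> Y x) Y = 1"
  using partition_pos[of Y \<beta> x] by (simp add: weight_def[abs_def] flip: sum_divide_distrib)

lemma weight_le:
  assumes "finite Y" "j \<in> Y" "0 \<le> \<beta>" "cost x j + \<delta> \<le> cost x y"
  shows "weight \<beta> Y x y \<le> exp (- \<beta> * \<delta>)"
proof -
  have "exp (- \<beta> * cost x j) \<le> (\<Sum>z\<in>Y. exp (- \<beta> * cost x z))"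
    using assms by (intro member_le_sum) auto
  then have "weight \<beta> Y x y \<le> exp (- \<beta> * cost x y) / exp (- \<beta> * cost x j)"
    unfolding weight_def by (intro divide_left_mono mult_pos_pos) (auto intro: less_le_trans[OF exp_gt_zero])
  also have "\<dots> = exp (- \<beta> * (cost x y - cost x j))" by (simp add: algebra_simps flip: exp_diff)
  also have "\<dots> \<le> exp (- \<beta> * \<delta>)"
    using assms mult_left_mono[of \<delta> "cost x y - cost x j" \<beta>] by simp
  finally show ?thesis .
qed

lemma weight_le_1:
  assumes "finite Y" "y \<in> Y"
  shows "weight \<beta> Y x y \<le> 1"
  using sum_weight[OF assms(1), of \<beta> x] assms member_le_sum[of y Y "weight \<beta> Y x"] weight_nonneg by fastforce

lemma continuous_slope: "continuous_on S (\<lambda>x. slope x y)"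
  unfolding slope_def by (intro continuous_intros)

lemma continuous_weight: "finite Y \<Longrightarrow> Y \<noteq> {} \<Longrightarrow> continuous_on S (\<lambda>x. weight \<beta> Y x y)"
  unfolding weight_def by (intro continuous_intros) (metis less_irrefl partition_pos)

lemma continuous_soft_min: "finite Y \<Longrightarrow> Y \<noteq> {} \<Longrightarrow> continuous_on S (soft_min \<beta> Y)"
  unfolding soft_min_def[abs_def] by (intro continuous_intros continuous_weight)

lemma continuous_soft_min_deriv:
  "finite Y \<Longrightarrow> Y \<noteq> {} \<Longrightarrow> continuous_on S (\<lambda>x. soft_min_deriv \<beta> Y x h)"
  unfolding soft_min_deriv_def[abs_def] by (intro continuous_intros continuous_weight continuous_slope)

lemma weight_deriv:
  assumes "finite Y" "Y \<noteq> {}"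
  shows "((\<lambda>x. weight \<beta> Y x y) has_derivative
    (\<lambda>h. - \<beta> * (weight \<beta> Y x y * (slope x y \<bullet> h - (\<Sum>z\<in>Y. weight \<beta> Y x z * (slope x z \<bullet> h)))))) (at x)"
proof -
  define E where "E x z = exp (- \<beta> * cost x z)" for x z
  define S where "S x = (\<Sum>z\<in>Y. E x z)" for x
  have S: "S x \<noteq> 0" using partition_pos[OF assms, of \<beta> x] by (simp add: S_def E_def)
  have E': "((\<lambda>x. E x z) has_derivative (\<lambda>h. - \<beta> * (E x z * (slope x z \<bullet> h)))) (at x)" for z
    unfolding E_def slope_def
    by (rule has_derivative_eq_rhs[OF has_derivative_exp]) (auto intro!: derivative_eq_intros cost_deriv)
  have S': "(S has_derivative (\<lambda>h. \<Sum>z\<in>Y. - \<beta> * (E x z * (slope x z \<bullet> h)))) (at x)"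
    unfolding S_def[abs_def] by (intro has_derivative_sum E')
  have "((\<lambda>x. E x y / S x) has_derivative (\<lambda>h. (- \<beta> * (E x y * (slope x y \<bullet> h)) * S x -
     E x y * (\<Sum>z\<in>Y. - \<beta> * (E x z * (slope x z \<bullet> h)))) / (S x * S x))) (at x)"
    by (rule has_derivative_divide'[OF E' S' S])
  moreover have "(- \<beta> * (E x y * (slope x y \<bullet> h)) * S x -
     E x y * (\<Sum>z\<in>Y. - \<beta> * (E x z * (slope x z \<bullet> h)))) / (S x * S x)
     = - \<beta> * (E x y / S x * (slope x y \<bullet> h - (\<Sum>z\<in>Y. E x z / S x * (slope x z \<bullet> h))))" for h
  proof -
    have "(\<Sum>z\<in>Y. - \<beta> * (E x z * (slope x z \<bullet> h))) = - \<beta> * (\<Sum>z\<in>Y. E x z * (slope x z \<bullet> h))"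
      by (simp add: sum_distrib_left)
    moreover have "(\<Sum>z\<in>Y. E x z / S x * (slope x z \<bullet> h)) = (\<Sum>z\<in>Y. E x z * (slope x z \<bullet> h)) / S x"
      by (simp add: sum_divide_distrib)
    ultimately show ?thesis using S by (simp add: field_simps)
  qed
  ultimately show ?thesis
    by (simp add: weight_def E_def S_def)
qed

lemma soft_min_has_derivative:
  assumes "finite Y" "Y \<noteq> {}"
  shows "(soft_min \<beta> Y has_derivative soft_min_deriv \<beta> Y x) (at x)"
proof -
  let ?w = "weight \<beta> Y x"
  have "(soft_min \<beta> Y has_derivative (\<lambda>h. \<Sum>y\<in>Y.
     (- \<beta> * (?w y * (slope x y \<bullet> h - (\<Sum>z\<in>Y. ?w z * (slope x z \<bullet> h))))) *\<^sub>R y)) (at x)"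
    unfolding soft_min_def[abs_def]
    by (intro has_derivative_sum has_derivative_scaleR_left weight_deriv[OF assms])
  moreover have "(\<Sum>y\<in>Y. (- \<beta> * (?w y * (slope x y \<bullet> h - (\<Sum>z\<in>Y. ?w z * (slope x z \<bullet> h))))) *\<^sub>R y)
    = soft_min_deriv \<beta> Y x h" for h
  proof -
    have "(\<Sum>y\<in>Y. (- \<beta> * (?w y * (slope x y \<bullet> h - (\<Sum>z\<in>Y. ?w z * (slope x z \<bullet> h))))) *\<^sub>R y)
      = (- \<beta>) *\<^sub>R (\<Sum>y\<in>Y. (?w y * (slope x y \<bullet> h - (\<Sum>z\<in>Y. ?w z * (slope x z \<bullet> h)))) *\<^sub>R y)"
      by (simp add: scaleR_right.sum sum_negf)
    also have "\<dots> = (- \<beta>) *\<^sub>R ((1/2) *\<^sub>R (\<Sum>y\<in>Y. \<Sum>z\<in>Y. (?w y * ?w z * (slope x y \<bullet> h - slope x z \<bullet> h)) *\<^sub>R (y - z)))"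
      by (subst weighted_covariance[OF sum_weight[OF assms]]) simp
    also have "\<dots> = (\<beta> / 2) *\<^sub>R - (\<Sum>y\<in>Y. \<Sum>z\<in>Y. (?w y * ?w z * (slope x y \<bullet> h - slope x z \<bullet> h)) *\<^sub>R (y - z))"
      by simp
    also have "- (\<Sum>y\<in>Y. \<Sum>z\<in>Y. (?w y * ?w z * (slope x y \<bullet> h - slope x z \<bullet> h)) *\<^sub>R (y - z))
      = (\<Sum>y\<in>Y. \<Sum>z\<in>Y. (?w y * ?w z * ((slope x y - slope x z) \<bullet> h)) *\<^sub>R (z - y))"
      unfolding sum_negf[symmetric] by (intro sum.cong refl) (simp add: inner_diff_left flip: scaleR_minus_right)
    finally show ?thesis by (simp add: soft_min_deriv_def)
  qed
  ultimately show ?thesis by simp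
qed

lemma competitor_diff: "z - y = t *\<^sub>R (grad H (slope x y) - grad H (slope x z))"
  using t_pos by (simp add: slope_def grad_dual flip: scaleR_diff_right)

lemma pair_monotone: "0 \<le> (slope x y - slope x z) \<bullet> (z - y)"
  using monotone_grad[of "slope x y" "slope x z"] t_pos
  unfolding competitor_diff[of z y x] by (simp add: inner_commute)

lemma pair_directional:
  assumes "cost x y \<le> cost x x + t" "cost x z \<le> cost x x + t"
  shows "convexity_modulus H r * (norm (slope x y - slope x z) * norm (z - y)) \<le> (slope x y - slope x z) \<bullet> (z - y)"
proof -
  have "norm (slope x y) \<le> r" "norm (slope x z) \<le> r"
    using assms unfolding slope_def by (auto intro!: r near_minimizer_speed)
  from directional_monotone[OF this] show ?thesis
    using t_pos unfolding competitor_diff[of z y x]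
    by (simp add: inner_commute mult.left_commute mult.commute)
qed

text \<open>The sum of the norms of the matrices \<open>(z - y) \<otimes> (slope x y - slope x z)\<close>, to bound error terms.\<close>

definition gap :: "(real^'d) set \<Rightarrow> real^'d \<Rightarrow> real" where
  "gap Y x = (\<Sum>y\<in>Y. \<Sum>z\<in>Y. norm (slope x y - slope x z) * norm (z - y))"

text \<open>
  The derivative of the regularized minimizer is a nonnegative combination of the rank one matrices
  \<open>(z - y) \<otimes> (p\<^sub>y - p\<^sub>z)\<close> with \<open>z - y = t (DH p\<^sub>y - DH p\<^sub>z)\<close>. Assumption (B) bounds the norm of each of
  them by its trace, as long as both slopes have norm at most \<open>r\<close>; the weights of the
  remaining pairs are exponentially small in \<open>\<beta>\<close>.
\<close>

lemma soft_min_deriv_directional: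
  fixes \<Phi> :: "real^'d^'d"
  assumes Y: "finite Y" "j \<in> Y" "cost x j \<le> cost x x + t / 2" and "0 \<le> \<beta>" and s: "norm \<Phi> \<le> s"
  shows "convexity_modulus H r * (\<Sum>\<alpha>\<in>UNIV. \<Sum>i\<in>UNIV. soft_min_deriv \<beta> Y x (axis i 1) $ \<alpha> * \<Phi> $ \<alpha> $ i)
    \<le> s * ((\<Sum>i\<in>UNIV. soft_min_deriv \<beta> Y x (axis i 1) $ i)
       + convexity_modulus H r * (\<beta> / 2 * exp (- \<beta> * (t / 2)) * gap Y x))"
proof -
  define \<kappa> where "\<kappa> = convexity_modulus H r"
  define w where "w = weight \<beta> Y x"
  define v where "v y z = slope x y - slope x z" for y z
  have \<kappa>: "0 < \<kappa>" unfolding \<kappa>_def by (rule modulus_pos[OF r_pos])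
  have s0: "0 \<le> s" using s norm_ge_zero[of \<Phi>] by linarith
  have entry: "soft_min_deriv \<beta> Y x (axis i 1) $ \<alpha> = (\<Sum>y\<in>Y. \<Sum>z\<in>Y. \<beta> / 2 * (w y * w z) * (v y z $ i * (z - y) $ \<alpha>))" for i \<alpha>
    by (simp add: soft_min_deriv_def sum_component w_def v_def inner_axis sum_distrib_left mult_ac)
  have "(\<Sum>\<alpha>\<in>UNIV. \<Sum>i\<in>UNIV. soft_min_deriv \<beta> Y x (axis i 1) $ \<alpha> * \<Phi> $ \<alpha> $ i)
    = (\<Sum>\<alpha>\<in>UNIV. \<Sum>i\<in>UNIV. \<Sum>y\<in>Y. \<Sum>z\<in>Y. \<beta> / 2 * (w y * w z) * (v y z $ i * (z - y) $ \<alpha> * \<Phi> $ \<alpha> $ i))"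
    unfolding entry sum_distrib_right by (simp add: mult_ac)
  also have "\<dots> = (\<Sum>\<alpha>\<in>UNIV. \<Sum>y\<in>Y. \<Sum>i\<in>UNIV. \<Sum>z\<in>Y. \<beta> / 2 * (w y * w z) * (v y z $ i * (z - y) $ \<alpha> * \<Phi> $ \<alpha> $ i))"
    by (intro sum.cong refl sum.swap)
  also have "\<dots> = (\<Sum>y\<in>Y. \<Sum>\<alpha>\<in>UNIV. \<Sum>i\<in>UNIV. \<Sum>z\<in>Y. \<beta> / 2 * (w y * w z) * (v y z $ i * (z - y) $ \<alpha> * \<Phi> $ \<alpha> $ i))"
    by (rule sum.swap)
  also have "\<dots> = (\<Sum>y\<in>Y. \<Sum>\<alpha>\<in>UNIV. \<Sum>z\<in>Y. \<Sum>i\<in>UNIV. \<beta> / 2 * (w y * w z) * (v y z $ i * (z - y) $ \<alpha> * \<Phi> $ \<alpha> $ i))"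
    by (intro sum.cong refl sum.swap)
  also have "\<dots> = (\<Sum>y\<in>Y. \<Sum>z\<in>Y. \<Sum>\<alpha>\<in>UNIV. \<Sum>i\<in>UNIV. \<beta> / 2 * (w y * w z) * (v y z $ i * (z - y) $ \<alpha> * \<Phi> $ \<alpha> $ i))"
    by (intro sum.cong refl sum.swap)
  also have "\<dots> = (\<Sum>y\<in>Y. \<Sum>z\<in>Y. \<beta> / 2 * (w y * w z) * (\<Sum>\<alpha>\<in>UNIV. \<Sum>i\<in>UNIV. v y z $ i * (z - y) $ \<alpha> * \<Phi> $ \<alpha> $ i))"
    by (simp only: sum_distrib_left)
  finally have lhs: "\<kappa> * (\<Sum>\<alpha>\<in>UNIV. \<Sum>i\<in>UNIV. soft_min_deriv \<beta> Y x (axis i 1) $ \<alpha> * \<Phi> $ \<alpha> $ i)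
    = (\<Sum>y\<in>Y. \<Sum>z\<in>Y. \<kappa> * (\<beta> / 2 * (w y * w z) * (\<Sum>\<alpha>\<in>UNIV. \<Sum>i\<in>UNIV. v y z $ i * (z - y) $ \<alpha> * \<Phi> $ \<alpha> $ i)))"
    by (simp only: sum_distrib_left)
  have "(\<Sum>i\<in>UNIV. soft_min_deriv \<beta> Y x (axis i 1) $ i) = (\<Sum>y\<in>Y. \<Sum>i\<in>UNIV. \<Sum>z\<in>Y. \<beta> / 2 * (w y * w z) * (v y z $ i * (z - y) $ i))"
    unfolding entry by (rule sum.swap)
  also have "\<dots> = (\<Sum>y\<in>Y. \<Sum>z\<in>Y. \<Sum>i\<in>UNIV. \<beta> / 2 * (w y * w z) * (v y z $ i * (z - y) $ i))"
    by (intro sum.cong refl sum.swap)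
  also have "\<dots> = (\<Sum>y\<in>Y. \<Sum>z\<in>Y. \<beta> / 2 * (w y * w z) * (v y z \<bullet> (z - y)))"
    by (simp only: sum_distrib_left inner_vec_def inner_real_def)
  finally have rhs: "s * ((\<Sum>i\<in>UNIV. soft_min_deriv \<beta> Y x (axis i 1) $ i) + \<kappa> * (\<beta> / 2 * exp (- \<beta> * (t / 2)) * gap Y x))
    = (\<Sum>y\<in>Y. \<Sum>z\<in>Y. s * (\<beta> / 2 * (w y * w z) * (v y z \<bullet> (z - y))
         + \<kappa> * (\<beta> / 2 * exp (- \<beta> * (t / 2)) * (norm (v y z) * norm (z - y)))))"
    by (simp only: gap_def v_def sum_distrib_left sum.distrib distrib_left)
  have "\<kappa> * (\<beta> / 2 * (w y * w z) * (\<Sum>\<alpha>\<in>UNIV. \<Sum>i\<in>UNIV. v y z $ i * (z - y) $ \<alpha> * \<Phi> $ \<alpha> $ i))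
     \<le> s * (\<beta> / 2 * (w y * w z) * (v y z \<bullet> (z - y))
         + \<kappa> * (\<beta> / 2 * exp (- \<beta> * (t / 2)) * (norm (v y z) * norm (z - y))))" if yz: "y \<in> Y" "z \<in> Y" for y z
  proof -
    define N where "N = norm (v y z) * norm (z - y)"
    have N: "0 \<le> N" by (simp add: N_def)
    have w: "0 \<le> w y" "0 \<le> w z" "w y \<le> 1" "w z \<le> 1"
      using yz Y by (auto simp: w_def weight_nonneg weight_le_1)
    have "(\<Sum>\<alpha>\<in>UNIV. \<Sum>i\<in>UNIV. v y z $ i * (z - y) $ \<alpha> * \<Phi> $ \<alpha> $ i) \<le> N * norm \<Phi>"
      unfolding N_def by (rule contraction_le)
    also have "\<dots> \<le> N * s" using s N by (rule mult_left_mono)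
    finally have "\<kappa> * (\<beta> / 2 * (w y * w z) * (\<Sum>\<alpha>\<in>UNIV. \<Sum>i\<in>UNIV. v y z $ i * (z - y) $ \<alpha> * \<Phi> $ \<alpha> $ i))
       \<le> \<kappa> * (\<beta> / 2 * (w y * w z) * (N * s))"
      using \<kappa> w \<open>0 \<le> \<beta>\<close> by (intro mult_left_mono) auto
    also have "\<dots> = s * (\<beta> / 2) * ((w y * w z) * (\<kappa> * N))" by simp
    also have "\<dots> \<le> s * (\<beta> / 2) * ((w y * w z) * (v y z \<bullet> (z - y)) + \<kappa> * (exp (- \<beta> * (t / 2)) * N))"
    proof (intro mult_left_mono)
      show "(w y * w z) * (\<kappa> * N) \<le> (w y * w z) * (v y z \<bullet> (z - y)) + \<kappa> * (exp (- \<beta> * (t / 2)) * N)"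
      proof (cases "cost x y \<le> cost x x + t \<and> cost x z \<le> cost x x + t")
        case True
        then have "\<kappa> * N \<le> v y z \<bullet> (z - y)"
          using pair_directional[of x y z] by (simp add: \<kappa>_def N_def v_def)
        then have "(w y * w z) * (\<kappa> * N) \<le> (w y * w z) * (v y z \<bullet> (z - y))"
          using w by (intro mult_left_mono) auto
        moreover have "0 \<le> \<kappa> * (exp (- \<beta> * (t / 2)) * N)" using \<kappa> N by simp
        ultimately show ?thesis by linarith
      next
        case False
        \<comment> \<open>one of the two competitors is worse than \<open>j\<close> by at least \<open>t / 2\<close>\<close>
        have "w y * w z \<le> exp (- \<beta> * (t / 2))"
        proof (cases "cost x y \<le> cost x x + t")
          case True
          with False have "w z \<le> exp (- \<beta> * (t / 2))"
            unfolding w_def using Y \<open>0 \<le> \<beta>\<close> by (intro weight_le[of Y j]) auto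
          then show ?thesis using mult_mono[of "w y" 1 "w z"] w by auto
        next
          case False
          then have "w y \<le> exp (- \<beta> * (t / 2))"
            unfolding w_def using Y \<open>0 \<le> \<beta>\<close> by (intro weight_le[of Y j]) auto
          then show ?thesis using mult_mono[of "w y" _ "w z" 1] w by auto
        qed
        then have "(w y * w z) * (\<kappa> * N) \<le> exp (- \<beta> * (t / 2)) * (\<kappa> * N)"
          using \<kappa> N by (intro mult_right_mono) auto
        moreover have "0 \<le> (w y * w z) * (v y z \<bullet> (z - y))"
          using w pair_monotone by (simp add: v_def)
        ultimately show ?thesis by (simp add: mult_ac)
      qed
    qed (use s0 \<open>0 \<le> \<beta>\<close> in auto)
    also have "\<dots> = s * (\<beta> / 2 * (w y * w z) * (v y z \<bullet> (z - y)) + \<kappa> * (\<beta> / 2 * exp (- \<beta> * (t / 2)) * N))"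
      by (simp add: distrib_left mult_ac)
    finally show ?thesis unfolding N_def .
  qed
  then show ?thesis
    unfolding \<kappa>_def[symmetric] lhs rhs by (intro sum_mono) auto
qed

end

section \<open>The derivative of the foot is bounded by its divergence\<close>

lemma borel_measurable_id_lebesgue: "(\<lambda>x::'a::euclidean_space. x) \<in> borel_measurable lebesgue"
  by (intro measurable_completion) simp

lemma integrable_lebesgue_of_lborel:
  fixes f :: "'a::euclidean_space \<Rightarrow> 'b::{banach, second_countable_topology}"
  shows "integrable lborel f \<Longrightarrow> integrable lebesgue f"
  by (simp add: integrable_completion borel_measurable_integrable)

lemma div_vec_row:
  fixes \<phi> :: "real^'n \<Rightarrow> real^'n^'m"
  assumes "C1_fun \<phi>"
  shows "div_vec (\<lambda>z. \<phi> z $ \<alpha>) x = (\<Sum>i\<in>UNIV. frechet_derivative \<phi> (at x) (axis i 1) $ \<alpha> $ i)"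
proof -
  have "((\<lambda>z. \<phi> z $ \<alpha>) has_derivative (\<lambda>h. frechet_derivative \<phi> (at x) h $ \<alpha>)) (at x)"
    by (rule bounded_linear.has_derivative[OF bounded_linear_vec_nth C1_fun_derivative[OF assms]])
  then show ?thesis
    by (simp add: div_vec_def frechet_derivative_at[symmetric])
qed

lemma continuous_div_vec_row:
  fixes \<phi> :: "real^'n \<Rightarrow> real^'n^'m"
  assumes "C1_fun \<phi>"
  shows "continuous_on UNIV (\<lambda>x. div_vec (\<lambda>z. \<phi> z $ \<alpha>) x)"
  using assms unfolding div_vec_row[OF assms] C1_fun_def by (auto intro!: continuous_intros)

lemma div_vec_row_eq_0:
  fixes \<phi> :: "real^'n \<Rightarrow> real^'n^'m"
  assumes "C1_fun \<phi>" "closed S" "\<And>x. x \<notin> S \<Longrightarrow> \<phi> x = 0" "x \<notin> S"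
  shows "div_vec (\<lambda>z. \<phi> z $ \<alpha>) x = 0"
  using has_derivative_zero_off_closed[OF C1_fun_derivative[OF assms(1)] assms(2,4,3)]
  by (simp add: div_vec_row[OF assms(1)])

lemma C1_fun_entry_derivative:
  fixes \<phi> :: "real^'n \<Rightarrow> real^'n^'m"
  assumes "C1_fun \<phi>"
  shows "((\<lambda>x. \<phi> x $ \<alpha> $ i) has_derivative (\<lambda>h. frechet_derivative \<phi> (at x) h $ \<alpha> $ i)) (at x)"
  using bounded_linear.has_derivative[OF bounded_linear_vec_nth
      bounded_linear.has_derivative[OF bounded_linear_vec_nth C1_fun_derivative[OF assms]]] .

lemma integral_div_by_parts:
  fixes Y :: "real^'n \<Rightarrow> real^'m" and \<phi> :: "real^'n \<Rightarrow> real^'n^'m"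
  assumes Y: "\<And>x. (Y has_derivative Y' x) (at x)" "\<And>h. continuous_on UNIV (\<lambda>x. Y' x h)"
    and \<phi>: "C1_fun \<phi>" "\<And>x. x \<notin> cball 0 \<rho> \<Longrightarrow> \<phi> x = 0"
  shows "(\<Sum>\<alpha>\<in>UNIV. LINT x|lborel. Y x $ \<alpha> * div_vec (\<lambda>z. \<phi> z $ \<alpha>) x)
    = - (LINT x|lborel. (\<Sum>\<alpha>\<in>UNIV. \<Sum>i\<in>UNIV. Y' x (axis i 1) $ \<alpha> * \<phi> x $ \<alpha> $ i))"
proof -
  let ?D = "\<lambda>x. frechet_derivative \<phi> (at x)"
  have Y\<alpha>: "((\<lambda>x. Y x $ \<alpha>) has_derivative (\<lambda>h. Y' x h $ \<alpha>)) (at x)" for \<alpha> x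
    by (rule bounded_linear.has_derivative[OF bounded_linear_vec_nth Y(1)])
  have cY: "continuous_on UNIV Y"
    using Y(1) by (meson continuous_at_imp_continuous_on has_derivative_continuous)
  have c\<phi>: "continuous_on UNIV \<phi>"
    using C1_fun_derivative[OF \<phi>(1)] by (meson continuous_at_imp_continuous_on has_derivative_continuous)
  have cD: "continuous_on UNIV (\<lambda>x. ?D x (axis i 1))" for i
    using \<phi>(1) by (simp add: C1_fun_def)
  have D0: "?D x h = 0" if "x \<notin> cball 0 \<rho>" for x h
    using has_derivative_zero_off_closed[OF C1_fun_derivative[OF \<phi>(1)] closed_cball that \<phi>(2)] by simp
  have i1: "integrable lborel (\<lambda>x. Y x $ \<alpha> * ?D x (axis i 1) $ \<alpha> $ i)" for \<alpha> i
    by (rule integrable_continuous_compact_support[of _ "cball 0 \<rho>"])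
       (use D0 in \<open>auto intro!: continuous_intros cY cD\<close>)
  have i2: "integrable lborel (\<lambda>x. Y' x (axis i 1) $ \<alpha> * \<phi> x $ \<alpha> $ i)" for \<alpha> i
    by (rule integrable_continuous_compact_support[of _ "cball 0 \<rho>"])
       (use \<phi>(2) in \<open>auto intro!: continuous_intros c\<phi> Y(2)\<close>)
  have row: "(LINT x|lborel. Y x $ \<alpha> * div_vec (\<lambda>z. \<phi> z $ \<alpha>) x)
    = (\<Sum>i\<in>UNIV. LINT x|lborel. Y x $ \<alpha> * ?D x (axis i 1) $ \<alpha> $ i)" for \<alpha>
    using i1 by (simp add: div_vec_row[OF \<phi>(1)] sum_distrib_left)
  have "(LINT x|lborel. Y x $ \<alpha> * ?D x (axis i 1) $ \<alpha> $ i)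
    = - (LINT x|lborel. Y' x (axis i 1) $ \<alpha> * \<phi> x $ \<alpha> $ i)" for \<alpha> i
    by (rule integral_by_parts_compact_support[OF Y\<alpha> _ C1_fun_entry_derivative[OF \<phi>(1)], of _ _ _ _ \<rho>])
       (use \<phi>(2) in \<open>auto intro!: continuous_intros cD Y(2)\<close>)
  then show ?thesis
    using i2 by (simp add: row sum_negf)
qed

lemma integral_inner_grad_by_parts:
  fixes Y :: "real^'n \<Rightarrow> real^'n"
  assumes Y: "\<And>x. (Y has_derivative Y' x) (at x)" "\<And>h. continuous_on UNIV (\<lambda>x. Y' x h)"
    and \<psi>: "\<And>x. (\<psi> has_derivative (\<lambda>h. g x \<bullet> h)) (at x)" "continuous_on UNIV g"
      "\<And>x. x \<notin> cball 0 \<rho> \<Longrightarrow> \<psi> x = 0"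
  shows "(LINT x|lborel. Y x \<bullet> g x) = - (LINT x|lborel. \<psi> x * (\<Sum>i\<in>UNIV. Y' x (axis i 1) $ i))"
proof -
  have cY: "continuous_on UNIV Y" and c\<psi>: "continuous_on UNIV \<psi>"
    using Y(1) \<psi>(1) by (meson continuous_at_imp_continuous_on has_derivative_continuous)+
  have g0: "g x = 0" if "x \<notin> cball 0 \<rho>" for x
    using fun_cong[OF has_derivative_zero_off_closed[OF \<psi>(1) closed_cball that \<psi>(3)], of "g x"] by simp
  have i1: "integrable lborel (\<lambda>x. Y x $ i * g x $ i)" for i
    by (rule integrable_continuous_compact_support[of _ "cball 0 \<rho>"])
       (use g0 in \<open>auto intro!: continuous_intros cY \<psi>(2)\<close>)
  have i2: "integrable lborel (\<lambda>x. Y' x (axis i 1) $ i * \<psi> x)" for i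
    by (rule integrable_continuous_compact_support[of _ "cball 0 \<rho>"])
       (use \<psi>(3) in \<open>auto intro!: continuous_intros c\<psi> Y(2)\<close>)
  have expand: "(LINT x|lborel. Y x \<bullet> g x) = (\<Sum>i\<in>UNIV. LINT x|lborel. Y x $ i * g x $ i)"
    using i1 by (simp add: inner_vec_def)
  have "(LINT x|lborel. Y x $ i * g x $ i) = - (LINT x|lborel. Y' x (axis i 1) $ i * \<psi> x)" for i
    using integral_by_parts_compact_support[of "\<lambda>x. Y x $ i" "\<lambda>x h. Y' x h $ i" "axis i 1" \<psi> "\<lambda>x h. g x \<bullet> h" \<rho>]
      bounded_linear.has_derivative[OF bounded_linear_vec_nth Y(1)] \<psi> Y(2)
    by (simp add: inner_axis continuous_intros)
  then show ?thesis
    using i2 by (simp add: expand sum_negf sum_distrib_left mult.commute)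
qed

context hopf_lax
begin

text \<open>
  The minimizer in the Hopf-Lax formula, at the points where it is unique; elsewhere the value \<open>0\<close> of
  \<open>backward_slope\<close> makes it the identity.
\<close>

abbreviation foot :: "real^'d \<Rightarrow> real^'d" where
  "foot x \<equiv> x - t *\<^sub>R backward_slope H u0 t x"

lemma exp_decay: "((\<lambda>\<beta>. K * (\<beta> / 2 * exp (- \<beta> * (t / 2)))) \<longlongrightarrow> 0) at_top"
proof -
  have "filterlim (\<lambda>\<beta>. (t / 2) * \<beta>) at_top at_top"
    using t_pos by (intro filterlim_tendsto_pos_mult_at_top[OF tendsto_const]) (auto intro: filterlim_ident)
  from filterlim_compose[OF tendsto_power_div_exp_0[of 1] this]
  have "((\<lambda>\<beta>. (K / t) * ((t / 2) * \<beta> / exp ((t / 2) * \<beta>))) \<longlongrightarrow> (K / t) * 0) at_top"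
    by (intro tendsto_mult tendsto_const) simp
  moreover have "(\<lambda>\<beta>. (K / t) * ((t / 2) * \<beta> / exp ((t / 2) * \<beta>))) = (\<lambda>\<beta>. K * (\<beta> / 2 * exp (- \<beta> * (t / 2))))"
    using t_pos by (simp add: fun_eq_iff exp_minus field_simps)
  ultimately show ?thesis by (simp only: mult_zero_right)
qed

text \<open>
  The sets \<open>Y n\<close> are finite nets of a ball that contains all minimizers for \<open>x \<in> cball 0 \<rho>\<close>, and \<open>\<beta> n\<close>
  is chosen after \<open>Y n\<close>, so large that the error term of \<open>soft_min_deriv_directional\<close> is at most
  \<open>1 / (n + 1)\<close> and the total weight of the competitors away from a unique minimizer tends to \<open>0\<close>.
\<close>

lemma soft_min_approximation:
  assumes "0 < \<rho>"
  obtains Y \<beta> where "\<And>n. finite (Y n)" "\<And>n. Y n \<noteq> {}" "\<And>n. Y n \<subseteq> cball 0 (\<rho> + t * R)" "\<And>n. 0 \<le> \<beta> n"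
    and "\<And>n x. x \<in> cball 0 \<rho> \<Longrightarrow> \<exists>j\<in>Y n. cost x j \<le> cost x x + t / 2"
    and "\<And>n x. x \<in> cball 0 \<rho> \<Longrightarrow> convexity_modulus H r * (\<beta> n / 2 * exp (- \<beta> n * (t / 2)) * gap (Y n) x) \<le> 1 / real (Suc n)"
    and "AE x in lborel. x \<in> cball 0 \<rho> \<longrightarrow> (\<lambda>n. soft_min (\<beta> n) (Y n) x) \<longlonglongrightarrow> foot x"
proof -
  define B where "B = cball (0::real^'d) (\<rho> + t * R)"
  have tR: "0 < t * R" using t_pos R_pos by simp
  have B_ne: "0 \<in> B" using assms tR by (simp add: B_def)
  have B_sub: "cball 0 \<rho> \<subseteq> B" using tR by (auto simp: B_def)
  \<comment> \<open>a competitor within \<open>\<delta>\<close> of \<open>x\<close> costs more than the competitor \<open>x\<close> by less than \<open>t / 2\<close>\<close>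
  have "uniformly_continuous_on (B \<times> B) (\<lambda>z. cost (fst z) (snd z))"
    by (intro compact_uniformly_continuous continuous_intros compact_Times) (auto simp: B_def)
  then obtain \<delta> where \<delta>: "0 < \<delta>" "\<And>z z'. z \<in> B \<times> B \<Longrightarrow> z' \<in> B \<times> B \<Longrightarrow> dist z' z < \<delta> \<Longrightarrow>
      dist (cost (fst z') (snd z')) (cost (fst z) (snd z)) < t / 2"
    using t_pos unfolding uniformly_continuous_on_def by (meson half_gt_zero)
  have "\<exists>Y. finite Y \<and> Y \<subseteq> B \<and> B \<subseteq> (\<Union>y\<in>Y. ball y (min \<delta> (1 / real (Suc n))))" for n
    using seq_compact_imp_totally_bounded[of B] \<delta>(1)
    by (simp add: B_def compact_imp_seq_compact)
  then obtain Y where Y: "\<And>n. finite (Y n)" "\<And>n. Y n \<subseteq> B"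
      "\<And>n. B \<subseteq> (\<Union>y\<in>Y n. ball y (min \<delta> (1 / real (Suc n))))" by metis
  have Y_ne: "Y n \<noteq> {}" for n using Y(3)[of n] B_ne by auto
  have net: "\<exists>j\<in>Y n. dist x j < \<delta> \<and> dist x j < 1 / real (Suc n)" if x: "x \<in> B" for x n
  proof -
    obtain j where "j \<in> Y n" "x \<in> ball j (min \<delta> (1 / real (Suc n)))" using Y(3)[of n] x by blast
    then show ?thesis by (intro bexI[of _ j]) (simp_all only: mem_ball dist_commute min_less_iff_conj)
  qed
  \<comment> \<open>the factor \<open>card (Y n)\<close> compensates the number of competitors in the tail estimate below\<close>
  have "\<exists>\<beta>. real (Suc n) * real (card (Y n)) \<le> \<beta> \<and>
    (\<forall>x\<in>cball 0 \<rho>. convexity_modulus H r * (\<beta> / 2 * exp (- \<beta> * (t / 2)) * gap (Y n) x) \<le> 1 / real (Suc n))" for n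
  proof -
    have "compact (gap (Y n) ` cball 0 \<rho>)"
      unfolding gap_def[abs_def] by (intro compact_continuous_image continuous_intros continuous_slope) auto
    then obtain G where G: "\<And>x. x \<in> cball 0 \<rho> \<Longrightarrow> gap (Y n) x \<le> G"
      by (meson bounded_imp_bdd_above bdd_above.E compact_imp_bounded imageI)
    have "\<forall>\<^sub>F \<beta> in at_top. convexity_modulus H r * G * (\<beta> / 2 * exp (- \<beta> * (t / 2))) < 1 / real (Suc n)"
      by (rule order_tendstoD[OF exp_decay]) simp
    then have "\<forall>\<^sub>F \<beta> in at_top. convexity_modulus H r * G * (\<beta> / 2 * exp (- \<beta> * (t / 2))) < 1 / real (Suc n)
       \<and> real (Suc n) * real (card (Y n)) \<le> \<beta>"
      by (intro eventually_conj eventually_ge_at_top)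
    then obtain \<beta> where \<beta>: "convexity_modulus H r * G * (\<beta> / 2 * exp (- \<beta> * (t / 2))) < 1 / real (Suc n)"
       "real (Suc n) * real (card (Y n)) \<le> \<beta>"
      by (metis (mono_tags, lifting) eventually_at_top_linorder order_refl)
    have \<beta>0: "0 \<le> \<beta>" using \<beta>(2) by (meson mult_nonneg_nonneg of_nat_0_le_iff order_trans)
    have "convexity_modulus H r * (\<beta> / 2 * exp (- \<beta> * (t / 2)) * gap (Y n) x) \<le> 1 / real (Suc n)" if "x \<in> cball 0 \<rho>" for x
    proof -
      have "convexity_modulus H r * (\<beta> / 2 * exp (- \<beta> * (t / 2)) * gap (Y n) x) \<le>
        convexity_modulus H r * (\<beta> / 2 * exp (- \<beta> * (t / 2)) * G)"
        using G[OF that] \<beta>0 modulus_pos[OF r_pos] by (intro mult_left_mono) auto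
      also have "\<dots> \<le> 1 / real (Suc n)" using \<beta>(1) by (simp add: mult_ac)
      finally show ?thesis .
    qed
    with \<beta>(2) show ?thesis by blast
  qed
  then obtain \<beta> where \<beta>: "\<And>n. real (Suc n) * real (card (Y n)) \<le> \<beta> n"
    "\<And>n x. x \<in> cball 0 \<rho> \<Longrightarrow> convexity_modulus H r * (\<beta> n / 2 * exp (- \<beta> n * (t / 2)) * gap (Y n) x) \<le> 1 / real (Suc n)"
    by metis
  have card_pos: "0 < card (Y n)" for n using Y(1) Y_ne by (simp add: card_gt_0_iff)
  have \<beta>_pos: "0 < \<beta> n" for n
    using \<beta>(1)[of n] card_pos[of n] by (meson less_le_trans mult_pos_pos of_nat_0_less_iff zero_less_Suc)
  have near: "\<exists>j\<in>Y n. cost x j \<le> cost x x + t / 2" if x: "x \<in> cball 0 \<rho>" for n x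
  proof -
    obtain j where j: "j \<in> Y n" "dist x j < \<delta>" using net x B_sub by blast
    have "x \<in> B" "j \<in> B" using x j(1) B_sub Y(2) by blast+
    then have "dist (cost x j) (cost x x) < t / 2"
      using \<delta>(2)[of "(x, x)" "(x, j)"] j(2) by (simp add: dist_Pair_Pair dist_commute)
    then have "cost x j \<le> cost x x + t / 2" unfolding dist_real_def by linarith
    then show ?thesis using j(1) by blast
  qed
  have conv: "(\<lambda>n. soft_min (\<beta> n) (Y n) x) \<longlonglongrightarrow> m"
    if x: "x \<in> cball 0 \<rho>" and m: "\<And>z. is_min x z \<longleftrightarrow> z = m" for x m
  proof -
    have mB: "m \<in> B"
      using near_minimizer_dist[OF min_is_near, of x m] m x norm_triangle_sub[of m x]
      by (simp add: B_def dist_norm norm_minus_commute)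
    show ?thesis
    proof (rule LIMSEQ_I)
      fix \<epsilon> :: real assume "0 < \<epsilon>"
      define A where "A = B - ball m (\<epsilon> / 2)"
      have "compact A" unfolding A_def B_def by (intro compact_diff) auto
      have "\<exists>\<eta>>0. \<forall>y\<in>A. cost x m + 2 * \<eta> \<le> cost x y"
      proof (cases "A = {}")
        case False
        have "\<exists>a\<in>A. \<forall>y\<in>A. cost x a \<le> cost x y"
          using \<open>compact A\<close> False by (intro continuous_attains_inf continuous_intros)
        then obtain a where a: "a \<in> A" "\<And>y. y \<in> A \<Longrightarrow> cost x a \<le> cost x y" by blast
        have "a \<noteq> m" using a(1) \<open>0 < \<epsilon>\<close> by (auto simp: A_def)
        then have "cost x m < cost x a"
          using m[of m] m[of a] unfolding is_min_def by (metis not_le order_trans)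
        then show ?thesis
          using a(2) by (intro exI[of _ "(cost x a - cost x m) / 2"]) (auto simp: field_simps)
      qed (auto intro: exI[of _ 1])
      then obtain \<eta> where \<eta>: "0 < \<eta>" "\<And>y. y \<in> A \<Longrightarrow> cost x m + 2 * \<eta> \<le> cost x y" by blast
      have "continuous_on UNIV (cost x)" by (intro continuous_intros)
      then obtain \<delta>' where \<delta>': "0 < \<delta>'" "\<And>j. dist j m < \<delta>' \<Longrightarrow> dist (cost x j) (cost x m) < \<eta>"
        using \<eta>(1) unfolding continuous_on_iff by (metis UNIV_I)
      define C where "C = 2 * (\<rho> + t * R)"
      have C: "0 < C" using assms tR by (simp add: C_def)
      have "\<forall>\<^sub>F n in sequentially. 1 / real (Suc n) < min \<delta>' (\<epsilon> * \<eta> / (2 * C))"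
        by (rule order_tendstoD[OF LIMSEQ_Suc[OF lim_1_over_n]])
           (use \<delta>' \<eta> C \<open>0 < \<epsilon>\<close> in auto)
      then obtain N where N: "\<And>n. N \<le> n \<Longrightarrow> 1 / real (Suc n) < min \<delta>' (\<epsilon> * \<eta> / (2 * C))"
        by (auto simp: eventually_sequentially)
      have "norm (soft_min (\<beta> n) (Y n) x - m) < \<epsilon>" if "N \<le> n" for n
      proof -
        define w where "w = weight (\<beta> n) (Y n) x"
        have sum_w: "sum w (Y n) = 1" unfolding w_def by (rule sum_weight[OF Y(1) Y_ne])
        obtain j where j: "j \<in> Y n" "dist m j < 1 / real (Suc n)" using net mB by blast
        then have "dist (cost x j) (cost x m) < \<eta>" using N[OF that] by (intro \<delta>') (auto simp: dist_commute)
        then have cj: "cost x j \<le> cost x m + \<eta>" by (auto simp: dist_real_def)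
        have tail: "exp (- \<beta> n * \<eta>) \<le> 1 / (real (Suc n) * real (card (Y n)) * \<eta>)"
        proof -
          have "real (Suc n) * real (card (Y n)) * \<eta> \<le> \<beta> n * \<eta>"
            using \<beta>(1) \<eta>(1) by (intro mult_right_mono) auto
          also have "\<dots> \<le> exp (\<beta> n * \<eta>)" using exp_ge_add_one_self[of "\<beta> n * \<eta>"] by linarith
          finally have "1 / exp (\<beta> n * \<eta>) \<le> 1 / (real (Suc n) * real (card (Y n)) * \<eta>)"
            using card_pos[of n] \<eta>(1) by (intro divide_left_mono mult_pos_pos) auto
          then show ?thesis by (simp add: exp_minus inverse_eq_divide)
        qed
        have "soft_min (\<beta> n) (Y n) x - m = (\<Sum>y\<in>Y n. w y *\<^sub>R (y - m))"
          using sum_w by (simp add: soft_min_def w_def scaleR_diff_right sum_subtractf flip: scaleR_left.sum)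
        also have "norm \<dots> \<le> (\<Sum>y\<in>Y n. norm (w y *\<^sub>R (y - m)))" by (rule norm_sum)
        also have "\<dots> \<le> (\<Sum>y\<in>Y n. w y * (\<epsilon> / 2) + exp (- \<beta> n * \<eta>) * C)"
        proof (rule sum_mono)
          fix y assume y: "y \<in> Y n"
          have w0: "0 \<le> w y" by (simp add: w_def weight_nonneg)
          show "norm (w y *\<^sub>R (y - m)) \<le> w y * (\<epsilon> / 2) + exp (- \<beta> n * \<eta>) * C"
          proof (cases "y \<in> A")
            case True
            have "w y \<le> exp (- \<beta> n * \<eta>)"
              unfolding w_def using Y(1) j(1) \<beta>_pos[of n] cj \<eta>(2)[OF True] by (intro weight_le[of _ j]) auto
            moreover have "norm (y - m) \<le> C"
              using y Y(2)[of n] mB norm_triangle_ineq4[of y m] by (force simp: B_def C_def)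
            ultimately have "w y * norm (y - m) \<le> exp (- \<beta> n * \<eta>) * C" using w0 by (intro mult_mono) auto
            moreover have "0 \<le> w y * (\<epsilon> / 2)" using w0 \<open>0 < \<epsilon>\<close> by simp
            ultimately show ?thesis using w0 by simp
          next
            case False
            then have "norm (y - m) \<le> \<epsilon> / 2" using y Y(2)[of n] by (auto simp: A_def dist_norm norm_minus_commute)
            then have "w y * norm (y - m) \<le> w y * (\<epsilon> / 2)" using w0 by (rule mult_left_mono)
            moreover have "0 \<le> exp (- \<beta> n * \<eta>) * C" using C by simp
            ultimately show ?thesis using w0 by simp
          qed
        qed
        also have "\<dots> = \<epsilon> / 2 + real (card (Y n)) * (exp (- \<beta> n * \<eta>) * C)"
          using sum_w by (simp add: sum.distrib flip: sum_distrib_right sum_divide_distrib)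
        also have "\<dots> \<le> \<epsilon> / 2 + real (card (Y n)) * (1 / (real (Suc n) * real (card (Y n)) * \<eta>) * C)"
          using tail C by (intro add_left_mono mult_left_mono mult_right_mono) auto
        also have "\<dots> = \<epsilon> / 2 + C / \<eta> * (1 / real (Suc n))"
          using card_pos[of n] by simp
        also have "\<dots> < \<epsilon> / 2 + C / \<eta> * (\<epsilon> * \<eta> / (2 * C))"
          using N[OF that] C \<eta>(1) by (intro add_strict_left_mono mult_strict_left_mono) auto
        also have "\<dots> = \<epsilon>" using C \<eta>(1) by simp
        finally show ?thesis .
      qed
      then show "\<exists>N. \<forall>n\<ge>N. norm (soft_min (\<beta> n) (Y n) x - m) < \<epsilon>" by blast
    qed
  qed
  show thesis
  proof (rule that)
    show "Y n \<subseteq> cball 0 (\<rho> + t * R)" for n using Y(2) by (simp add: B_def)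
    show "0 \<le> \<beta> n" for n using \<beta>_pos[of n] by simp
    show "AE x in lborel. x \<in> cball 0 \<rho> \<longrightarrow> (\<lambda>n. soft_min (\<beta> n) (Y n) x) \<longlonglongrightarrow> foot x"
      using AE_unique_minimizer
    proof eventually_elim
      case (elim x)
      then obtain y where y: "\<forall>z. is_min x z \<longleftrightarrow> z = y" by blast
      show ?case using conv[of x y] y backward_slope_unique[OF y] by auto
    qed
  qed (use Y(1) Y_ne near \<beta>(2) in auto)
qed

lemma norm_soft_min:
  assumes "finite Y" "Y \<noteq> {}" "Y \<subseteq> cball 0 C"
  shows "norm (soft_min \<beta> Y x) \<le> C"
proof -
  have "norm (soft_min \<beta> Y x) \<le> (\<Sum>y\<in>Y. weight \<beta> Y x y * C)"
    unfolding soft_min_def using assms weight_nonneg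
    by (intro sum_norm_le) (auto intro!: mult_left_mono)
  then show ?thesis using sum_weight[OF assms(1,2)] by (simp flip: sum_distrib_right)
qed

lemma backward_slope_measurable: "backward_slope H u0 t \<in> borel_measurable lebesgue"
proof -
  have "(\<lambda>x. indicator (cball 0 (real (Suc k))) x *\<^sub>R foot x) \<in> borel_measurable lebesgue" for k
  proof -
    obtain Y \<beta> where Y: "\<And>n. finite (Y n)" "\<And>n. Y n \<noteq> {}"
      and AE: "AE x in lborel. x \<in> cball 0 (real (Suc k)) \<longrightarrow> (\<lambda>n. soft_min (\<beta> n) (Y n) x) \<longlonglongrightarrow> foot x"
      by (rule soft_min_approximation[of "real (Suc k)"]) auto
    let ?g = "\<lambda>x. indicator (cball 0 (real (Suc k))) x *\<^sub>R lim (\<lambda>n. soft_min (\<beta> n) (Y n) x)"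
    have "soft_min (\<beta> n) (Y n) \<in> borel_measurable borel" for n
      using continuous_soft_min[OF Y] by (rule borel_measurable_continuous_onI)
    then have "?g \<in> borel_measurable borel"
      by (intro borel_measurable_scaleR borel_measurable_indicator borel_measurable_lim_metric borel_closed) auto
    then have "?g \<in> borel_measurable lebesgue"
      by (simp add: measurable_completion)
    moreover have "AE x in lebesgue. ?g x = indicator (cball 0 (real (Suc k))) x *\<^sub>R foot x"
      using AE_completion[OF AE] by eventually_elim (auto simp: indicator_def limI)
    ultimately show ?thesis by (rule borel_measurable_AE)
  qed
  then have "foot \<in> borel_measurable lebesgue"
  proof (rule borel_measurable_LIMSEQ_metric)
    fix x :: "real^'d"
    obtain N where "norm x \<le> real N" using real_arch_simple by blast
    then have "indicator (cball 0 (real (Suc k))) x *\<^sub>R foot x = foot x" if "N \<le> k" for k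
      using that by simp
    then show "(\<lambda>k. indicator (cball 0 (real (Suc k))) x *\<^sub>R foot x) \<longlonglongrightarrow> foot x"
      by (intro tendsto_eventually) (auto simp: eventually_sequentially)
  qed
  then have "(\<lambda>x. (x - foot x) /\<^sub>R t) \<in> borel_measurable lebesgue"
    by (intro borel_measurable_scaleR[OF borel_measurable_const borel_measurable_diff[OF borel_measurable_id_lebesgue]])
  moreover have "(\<lambda>x. (x - foot x) /\<^sub>R t) = backward_slope H u0 t"
    using t_pos by (simp add: fun_eq_iff)
  ultimately show ?thesis by (simp only:)
qed

text \<open>
  The inequality \<open>\<kappa> |D foot| \<le> div foot\<close> in weak form: the left hand side pairs \<open>\<kappa> D foot\<close> with the
  matrix field \<open>\<phi>\<close>, the right hand side pairs \<open>div foot\<close> with a function \<open>\<psi>\<close> that dominates \<open>|\<phi>|\<close>. It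
  passes to the limit from the regularized minimizers by dominated convergence.
\<close>

lemma foot_derivative_le_divergence:
  fixes \<phi> :: "real^'d \<Rightarrow> real^'d^'d" and \<psi> :: "real^'d \<Rightarrow> real"
  assumes \<phi>: "C1_fun \<phi>" "\<And>x. x \<notin> cball 0 \<rho> \<Longrightarrow> \<phi> x = 0"
    and \<psi>: "\<And>x. (\<psi> has_derivative (\<lambda>h. g x \<bullet> h)) (at x)" "continuous_on UNIV g"
      "\<And>x. x \<notin> cball 0 \<rho> \<Longrightarrow> \<psi> x = 0"
    and le: "\<And>x. norm (\<phi> x) \<le> \<psi> x" and \<rho>: "0 < \<rho>"
  shows "convexity_modulus H r * - (\<Sum>\<alpha>\<in>UNIV. LINT x|lebesgue. foot x $ \<alpha> * div_vec (\<lambda>z. \<phi> z $ \<alpha>) x)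
    \<le> - (LINT x|lebesgue. foot x \<bullet> g x)"
proof -
  obtain Y \<beta> where Y: "\<And>n. finite (Y n)" "\<And>n. Y n \<noteq> {}" "\<And>n. Y n \<subseteq> cball 0 (\<rho> + t * R)" "\<And>n. 0 \<le> \<beta> n"
    and near: "\<And>n x. x \<in> cball 0 \<rho> \<Longrightarrow> \<exists>j\<in>Y n. cost x j \<le> cost x x + t / 2"
    and err: "\<And>n x. x \<in> cball 0 \<rho> \<Longrightarrow> convexity_modulus H r * (\<beta> n / 2 * exp (- \<beta> n * (t / 2)) * gap (Y n) x) \<le> 1 / real (Suc n)"
    and AE: "AE x in lborel. x \<in> cball 0 \<rho> \<longrightarrow> (\<lambda>n. soft_min (\<beta> n) (Y n) x) \<longlonglongrightarrow> foot x"
    by (rule soft_min_approximation[OF \<rho>]) blast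
  define S where "S n = soft_min (\<beta> n) (Y n)" for n
  define S' where "S' n = soft_min_deriv (\<beta> n) (Y n)" for n
  define \<kappa> where "\<kappa> = convexity_modulus H r"
  define C where "C = \<rho> + t * R"
  have S_deriv: "(S n has_derivative S' n x) (at x)" for n x
    unfolding S_def S'_def by (rule soft_min_has_derivative[OF Y(1,2)])
  have S_cont: "continuous_on UNIV (S n)" for n
    unfolding S_def by (rule continuous_soft_min[OF Y(1,2)])
  have S'_cont: "continuous_on UNIV (\<lambda>x. S' n x h)" for n h
    unfolding S'_def by (rule continuous_soft_min_deriv[OF Y(1,2)])
  have S_bound: "norm (S n x) \<le> C" for n x
    unfolding S_def C_def by (rule norm_soft_min[OF Y(1-3)])
  have c\<phi>: "continuous_on UNIV \<phi>" and c\<psi>: "continuous_on UNIV \<psi>"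
    using C1_fun_derivative[OF \<phi>(1)] \<psi>(1) by (meson continuous_at_imp_continuous_on has_derivative_continuous)+
  have g0: "g x = 0" if "x \<notin> cball 0 \<rho>" for x
    using fun_cong[OF has_derivative_zero_off_closed[OF \<psi>(1) closed_cball that \<psi>(3)], of "g x"] by simp
  have div0: "div_vec (\<lambda>z. \<phi> z $ \<alpha>) x = 0" if "x \<notin> cball 0 \<rho>" for x \<alpha>
    by (rule div_vec_row_eq_0[OF \<phi>(1) closed_cball \<phi>(2) that])
  have parts: "(\<Sum>\<alpha>\<in>UNIV. LINT x|lborel. S n x $ \<alpha> * div_vec (\<lambda>z. \<phi> z $ \<alpha>) x)
      = - (LINT x|lborel. (\<Sum>\<alpha>\<in>UNIV. \<Sum>i\<in>UNIV. S' n x (axis i 1) $ \<alpha> * \<phi> x $ \<alpha> $ i))" for n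
    by (rule integral_div_by_parts[OF S_deriv S'_cont \<phi>])
  have parts': "(LINT x|lborel. S n x \<bullet> g x) = - (LINT x|lborel. \<psi> x * (\<Sum>i\<in>UNIV. S' n x (axis i 1) $ i))" for n
    by (rule integral_inner_grad_by_parts[OF S_deriv S'_cont \<psi>])
  have ineq: "\<kappa> * - (\<Sum>\<alpha>\<in>UNIV. LINT x|lborel. S n x $ \<alpha> * div_vec (\<lambda>z. \<phi> z $ \<alpha>) x)
      \<le> - (LINT x|lborel. S n x \<bullet> g x) + 1 / real (Suc n) * (LINT x|lborel. \<psi> x)" for n
  proof -
    have "\<kappa> * - (\<Sum>\<alpha>\<in>UNIV. LINT x|lborel. S n x $ \<alpha> * div_vec (\<lambda>z. \<phi> z $ \<alpha>) x)
      = (LINT x|lborel. \<kappa> * (\<Sum>\<alpha>\<in>UNIV. \<Sum>i\<in>UNIV. S' n x (axis i 1) $ \<alpha> * \<phi> x $ \<alpha> $ i))"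
      by (subst parts) simp
    also have "\<dots> \<le> (LINT x|lborel. \<psi> x * (\<Sum>i\<in>UNIV. S' n x (axis i 1) $ i) + 1 / real (Suc n) * \<psi> x)"
    proof (rule integral_mono)
      show "integrable lborel (\<lambda>x. \<kappa> * (\<Sum>\<alpha>\<in>UNIV. \<Sum>i\<in>UNIV. S' n x (axis i 1) $ \<alpha> * \<phi> x $ \<alpha> $ i))"
        by (rule integrable_continuous_compact_support[of _ "cball 0 \<rho>"])
           (use \<phi>(2) in \<open>auto intro!: continuous_intros c\<phi> S'_cont\<close>)
      show "integrable lborel (\<lambda>x. \<psi> x * (\<Sum>i\<in>UNIV. S' n x (axis i 1) $ i) + 1 / real (Suc n) * \<psi> x)"
        by (rule integrable_continuous_compact_support[of _ "cball 0 \<rho>"])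
           (use \<psi>(3) in \<open>auto intro!: continuous_intros c\<psi> S'_cont simp del: of_nat_Suc\<close>)
      fix x
      show "\<kappa> * (\<Sum>\<alpha>\<in>UNIV. \<Sum>i\<in>UNIV. S' n x (axis i 1) $ \<alpha> * \<phi> x $ \<alpha> $ i)
        \<le> \<psi> x * (\<Sum>i\<in>UNIV. S' n x (axis i 1) $ i) + 1 / real (Suc n) * \<psi> x"
      proof (cases "x \<in> cball 0 \<rho>")
        case True
        then obtain j where j: "j \<in> Y n" "cost x j \<le> cost x x + t / 2" using near by blast
        have "0 \<le> \<psi> x" using le[of x] norm_ge_zero[of "\<phi> x"] by linarith
        have "\<kappa> * (\<Sum>\<alpha>\<in>UNIV. \<Sum>i\<in>UNIV. S' n x (axis i 1) $ \<alpha> * \<phi> x $ \<alpha> $ i)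
          \<le> \<psi> x * ((\<Sum>i\<in>UNIV. S' n x (axis i 1) $ i) + \<kappa> * (\<beta> n / 2 * exp (- \<beta> n * (t / 2)) * gap (Y n) x))"
          unfolding \<kappa>_def S'_def by (rule soft_min_deriv_directional[OF Y(1) j Y(4) le])
        also have "\<dots> \<le> \<psi> x * ((\<Sum>i\<in>UNIV. S' n x (axis i 1) $ i) + 1 / real (Suc n))"
          unfolding \<kappa>_def using err[OF True, of n] \<open>0 \<le> \<psi> x\<close> by (intro mult_left_mono add_left_mono)
        finally show ?thesis by (simp add: distrib_left mult.commute)
      qed (use \<phi>(2) \<psi>(3) in simp)
    qed
    also have "\<dots> = (LINT x|lborel. \<psi> x * (\<Sum>i\<in>UNIV. S' n x (axis i 1) $ i)) + 1 / real (Suc n) * (LINT x|lborel. \<psi> x)"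
    proof -
      have "integrable lborel (\<lambda>x. \<psi> x * (\<Sum>i\<in>UNIV. S' n x (axis i 1) $ i))"
        by (rule integrable_continuous_compact_support[of _ "cball 0 \<rho>"])
           (use \<psi>(3) in \<open>auto intro!: continuous_intros c\<psi> S'_cont\<close>)
      moreover have "integrable lborel \<psi>"
        by (rule integrable_continuous_compact_support[of _ "cball 0 \<rho>"]) (use \<psi>(3) c\<psi> in auto)
      ultimately show ?thesis by simp
    qed
    finally show ?thesis
      by (subst parts') simp
  qed
  have [measurable]: "S n \<in> borel_measurable borel" for n
    using S_cont by (rule borel_measurable_continuous_onI)
  have foot_meas: "foot \<in> borel_measurable lebesgue"
    by (intro borel_measurable_diff borel_measurable_id_lebesgue
      borel_measurable_scaleR[OF borel_measurable_const backward_slope_measurable])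
  have lim: "(\<lambda>n. LINT x|lborel. S n x \<bullet> G x) \<longlonglongrightarrow> (LINT x|lebesgue. foot x \<bullet> G x)"
    if G: "continuous_on UNIV G" "\<And>x. x \<notin> cball 0 \<rho> \<Longrightarrow> G x = 0" for G :: "real^'d \<Rightarrow> real^'d"
  proof -
    have [measurable]: "G \<in> borel_measurable borel"
      using G(1) by (rule borel_measurable_continuous_onI)
    have "(\<lambda>n. LINT x|lebesgue. S n x \<bullet> G x) \<longlonglongrightarrow> (LINT x|lebesgue. foot x \<bullet> G x)"
    proof (rule integral_dominated_convergence[where w = "\<lambda>x. C * norm (G x)"])
      show "(\<lambda>x. foot x \<bullet> G x) \<in> borel_measurable lebesgue"
        by (rule borel_measurable_inner[OF foot_meas measurable_completion]) simp
      show "(\<lambda>x. S n x \<bullet> G x) \<in> borel_measurable lebesgue" for n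
        by (intro measurable_completion) measurable
      have "integrable lborel (\<lambda>x. C * norm (G x))"
        by (rule integrable_continuous_compact_support[of _ "cball 0 \<rho>"])
           (use G in \<open>auto intro!: continuous_intros\<close>)
      then show "integrable lebesgue (\<lambda>x. C * norm (G x))" by (rule integrable_lebesgue_of_lborel)
      show "AE x in lebesgue. (\<lambda>n. S n x \<bullet> G x) \<longlonglongrightarrow> foot x \<bullet> G x"
        using AE_completion[OF AE]
      proof eventually_elim
        case (elim x)
        show ?case
        proof (cases "x \<in> cball 0 \<rho>")
          case True
          then show ?thesis using elim unfolding S_def by (intro tendsto_intros) auto
        qed (simp add: G(2))
      qed
      show "AE x in lebesgue. norm (S n x \<bullet> G x) \<le> C * norm (G x)" for n
      proof (rule AE_I2)
        fix x
        have "\<bar>S n x \<bullet> G x\<bar> \<le> norm (S n x) * norm (G x)" by (rule Cauchy_Schwarz_ineq2)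
        also have "\<dots> \<le> C * norm (G x)" using S_bound by (rule mult_right_mono) simp
        finally show "norm (S n x \<bullet> G x) \<le> C * norm (G x)" by simp
      qed
    qed
    moreover have "(LINT x|lebesgue. S n x \<bullet> G x) = (LINT x|lborel. S n x \<bullet> G x)" for n
      by (intro integral_completion) measurable
    ultimately show ?thesis by simp
  qed
  \<comment> \<open>\<open>lim\<close> applied to the field whose only nonzero component is the divergence of row \<open>\<alpha>\<close>\<close>
  have lim_div: "(\<lambda>n. LINT x|lborel. S n x $ \<alpha> * div_vec (\<lambda>z. \<phi> z $ \<alpha>) x)
      \<longlonglongrightarrow> (LINT x|lebesgue. foot x $ \<alpha> * div_vec (\<lambda>z. \<phi> z $ \<alpha>) x)" for \<alpha>
  proof -
    have "continuous_on UNIV (\<lambda>x. axis \<alpha> (div_vec (\<lambda>z. \<phi> z $ \<alpha>) x) :: real^'d)"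
      unfolding axis_def
    proof (rule continuous_on_vec_lambda)
      fix i
      show "continuous_on UNIV (\<lambda>x. if i = \<alpha> then div_vec (\<lambda>z. \<phi> z $ \<alpha>) x else 0)"
        by (cases "i = \<alpha>") (simp_all add: continuous_div_vec_row[OF \<phi>(1)])
    qed
    from lim[OF this] show ?thesis by (simp add: div0 inner_axis axis_def[of _ 0] zero_vec_def[symmetric])
  qed
  have "(\<lambda>n. \<kappa> * - (\<Sum>\<alpha>\<in>UNIV. LINT x|lborel. S n x $ \<alpha> * div_vec (\<lambda>z. \<phi> z $ \<alpha>) x))
    \<longlonglongrightarrow> \<kappa> * - (\<Sum>\<alpha>\<in>UNIV. LINT x|lebesgue. foot x $ \<alpha> * div_vec (\<lambda>z. \<phi> z $ \<alpha>) x)"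
    by (intro tendsto_intros lim_div)
  moreover have "(\<lambda>n. - (LINT x|lborel. S n x \<bullet> g x) + 1 / real (Suc n) * (LINT x|lborel. \<psi> x))
    \<longlonglongrightarrow> - (LINT x|lebesgue. foot x \<bullet> g x) + 0 * (LINT x|lborel. \<psi> x)"
    by (intro tendsto_intros lim[OF \<psi>(2) g0] LIMSEQ_Suc[OF lim_1_over_n])
  ultimately show ?thesis
    unfolding \<kappa>_def[symmetric] using ineq
    by (intro LIMSEQ_le[where X = "\<lambda>n. \<kappa> * - (\<Sum>\<alpha>\<in>UNIV. LINT x|lborel. S n x $ \<alpha> * div_vec (\<lambda>z. \<phi> z $ \<alpha>) x)"
          and Y = "\<lambda>n. - (LINT x|lborel. S n x \<bullet> g x) + 1 / real (Suc n) * (LINT x|lborel. \<psi> x)"]) auto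
qed

end

section \<open>Cutoffs adapted to the boundary\<close>

text \<open>
  The constant with which the boundary measure controls the cutoffs below. Only its dependence
  on the dimension matters.
\<close>

definition cutoff_const :: "nat \<Rightarrow> real" where
  "cutoff_const d = 32 * 2 ^ d * unit_ball_vol (real d) * (2 ^ (d - 1) / unit_ball_vol (real (d - 1)))"

lemma cutoff_const_pos: "0 < cutoff_const d"
  by (simp add: cutoff_const_def)

lemma integral_norm_bump_grad:
  fixes c :: "real^'n"
  assumes "0 < r"
  shows "(LINT x|lborel. norm (bump_grad c r x)) \<le> 16 * 2 ^ CARD('n) * unit_ball_vol (real CARD('n)) * r ^ (CARD('n) - 1)"
    and "integrable lborel (\<lambda>x. norm (bump_grad c r x))"
proof -
  have zero: "norm (bump_grad c r x) = 0" if "x \<notin> cball c (2 * r)" for x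
    using norm_bump_grad[OF assms, of c x] that by simp
  show i: "integrable lborel (\<lambda>x. norm (bump_grad c r x))"
    by (rule integrable_continuous_compact_support[of _ "cball c (2 * r)"])
       (use zero in \<open>auto intro!: continuous_intros continuous_bump_grad\<close>)
  have "integrable lborel (\<lambda>x. indicator (cball c (2 * r)) x *\<^sub>R (16 / r))"
    by (rule borel_integrable_compact) auto
  then have "(LINT x|lborel. norm (bump_grad c r x)) \<le> (LINT x|lborel. indicator (cball c (2 * r)) x * (16 / r))"
    using i norm_bump_grad[OF assms] by (intro integral_mono) auto
  also have "\<dots> = unit_ball_vol (real CARD('n)) * (2 * r) ^ CARD('n) * (16 / r)"
    using content_cball[of "2 * r" c] assms by simp
  also have "\<dots> = 16 * 2 ^ CARD('n) * unit_ball_vol (real CARD('n)) * r ^ (CARD('n) - 1)"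
    using assms power_minus_mult[of "CARD('n)" r] by (simp add: power_mult_distrib field_simps)
  finally show "(LINT x|lborel. norm (bump_grad c r x)) \<le> 16 * 2 ^ CARD('n) * unit_ball_vol (real CARD('n)) * r ^ (CARD('n) - 1)" .
qed

lemma slightly_larger_radius:
  assumes "0 < \<epsilon>" "0 < \<delta>"
  shows "\<exists>r>D. r \<le> D + \<delta> \<and> c * (r / 2) ^ k \<le> c * (D / 2) ^ k + (\<epsilon>::real)"
proof -
  have "((\<lambda>r. c * (r / 2) ^ k) \<longlongrightarrow> c * (D / 2) ^ k) (at_right D)"
    by (intro tendsto_intros) simp
  then have "\<forall>\<^sub>F r in at_right D. c * (r / 2) ^ k < c * (D / 2) ^ k + \<epsilon>"
    using assms by (intro order_tendstoD) auto
  moreover have "\<forall>\<^sub>F r in at_right D. D < r \<and> r < D + \<delta>"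
    using assms by (intro eventually_conj eventually_at_right_less eventually_at_rightI[of D "D + \<delta>"]) auto
  ultimately have "\<forall>\<^sub>F r in at_right D. D < r \<and> r < D + \<delta> \<and> c * (r / 2) ^ k < c * (D / 2) ^ k + \<epsilon>"
    by eventually_elim auto
  then obtain r where "D < r \<and> r < D + \<delta> \<and> c * (r / 2) ^ k < c * (D / 2) ^ k + \<epsilon>"
    using eventually_happens'[OF trivial_limit_at_right_real] by blast
  then show ?thesis by (intro exI[of _ r]) auto
qed

text \<open>
  A cover that nearly realizes the Hausdorff content is replaced by balls centred on \<open>A\<close>. Their radii
  slightly exceed the diameters of the covering sets, so that the balls are open and not degenerate.
\<close>

lemma small_ball_cover:
  fixes A :: "'a::metric_space set"
  assumes "compact A" "hausdorff_measure k A = ennreal h" "0 \<le> h" "0 < \<epsilon>" "0 < \<delta>"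
  obtains I :: "nat set" and c \<rho> where "finite I" "\<And>i. i \<in> I \<Longrightarrow> c i \<in> A \<and> 0 < \<rho> i \<and> \<rho> i \<le> 2 * \<delta>"
    "A \<subseteq> (\<Union>i\<in>I. ball (c i) (\<rho> i))" "(\<Sum>i\<in>I. unit_ball_vol (real k) * (\<rho> i / 2) ^ k) \<le> h + \<epsilon>"
proof -
  let ?\<omega> = "unit_ball_vol (real k)"
  have "hausdorff_content k \<delta> A \<le> hausdorff_measure k A"
    unfolding hausdorff_measure_def using assms by (intro SUP_upper) auto
  also have "\<dots> < ennreal (h + \<epsilon> / 2)" using assms by (simp add: ennreal_lessI)
  finally obtain C :: "nat \<Rightarrow> 'a set" where C: "A \<subseteq> (\<Union>i. C i)" "\<And>i. bounded (C i)" "\<And>i. diameter (C i) \<le> \<delta>"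
    and sum_C: "(\<Sum>i. if C i = {} then 0 else ennreal (?\<omega> * (diameter (C i) / 2) ^ k)) < ennreal (h + \<epsilon> / 2)"
    unfolding hausdorff_content_def INF_less_iff by blast
  define J where "J = {i. C i \<inter> A \<noteq> {}}"
  have "\<exists>c. c \<in> C i \<inter> A" if "i \<in> J" for i using that by (auto simp: J_def)
  then obtain c where c: "\<And>i. i \<in> J \<Longrightarrow> c i \<in> C i \<inter> A" by metis
  have "\<exists>r>diameter (C i). r \<le> diameter (C i) + \<delta> \<and> ?\<omega> * (r / 2) ^ k \<le> ?\<omega> * (diameter (C i) / 2) ^ k + \<epsilon> / 2 * (1 / 2) ^ Suc i" for i
    using assms by (intro slightly_larger_radius) auto
  then obtain \<rho> where \<rho>: "\<And>i. diameter (C i) < \<rho> i" "\<And>i. \<rho> i \<le> diameter (C i) + \<delta>"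
      "\<And>i. ?\<omega> * (\<rho> i / 2) ^ k \<le> ?\<omega> * (diameter (C i) / 2) ^ k + \<epsilon> / 2 * (1 / 2) ^ Suc i" by metis
  have diam: "0 \<le> diameter (C i)" for i using C(2) by (rule diameter_ge_0)
  have "A \<subseteq> (\<Union>i\<in>J. ball (c i) (\<rho> i))"
  proof
    fix x assume "x \<in> A"
    then obtain i where i: "x \<in> C i" using C(1) by blast
    then have "i \<in> J" using \<open>x \<in> A\<close> by (auto simp: J_def)
    moreover have "dist (c i) x \<le> diameter (C i)"
      using c[OF \<open>i \<in> J\<close>] i by (intro diameter_bounded_bound C(2)) auto
    ultimately show "x \<in> (\<Union>i\<in>J. ball (c i) (\<rho> i))" using \<rho>(1)[of i] by (auto intro!: bexI[of _ i])
  qed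
  then obtain I where I: "I \<subseteq> J" "finite I" "A \<subseteq> (\<Union>i\<in>I. ball (c i) (\<rho> i))"
    using compactE_image[OF assms(1), of J "\<lambda>i. ball (c i) (\<rho> i)"] by auto
  have "ennreal (\<Sum>i\<in>I. ?\<omega> * (diameter (C i) / 2) ^ k) = (\<Sum>i\<in>I. ennreal (?\<omega> * (diameter (C i) / 2) ^ k))"
    using diam by (intro sum_ennreal[symmetric]) simp
  also have "\<dots> = (\<Sum>i\<in>I. if C i = {} then 0 else ennreal (?\<omega> * (diameter (C i) / 2) ^ k))"
    using I(1) by (intro sum.cong refl) (auto simp: J_def)
  also have "\<dots> \<le> (\<Sum>i. if C i = {} then 0 else ennreal (?\<omega> * (diameter (C i) / 2) ^ k))"
    by (intro sum_le_suminf I) auto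
  finally have "ennreal (\<Sum>i\<in>I. ?\<omega> * (diameter (C i) / 2) ^ k) < ennreal (h + \<epsilon> / 2)"
    using sum_C by (rule le_less_trans)
  then have sum_D: "(\<Sum>i\<in>I. ?\<omega> * (diameter (C i) / 2) ^ k) < h + \<epsilon> / 2"
    using diam by (subst (asm) ennreal_less_iff) (auto intro!: sum_nonneg)
  have "(\<Sum>i\<in>I. (1 / 2 :: real) ^ Suc i) \<le> (\<Sum>i. (1 / 2) ^ Suc i)"
    using I(2) power_half_series by (intro sum_le_suminf) (auto dest: sums_summable)
  then have "(\<Sum>i\<in>I. (1 / 2 :: real) ^ Suc i) \<le> 1"
    using sums_unique[OF power_half_series] by simp
  then have "\<epsilon> / 2 * (\<Sum>i\<in>I. (1 / 2) ^ Suc i) \<le> \<epsilon> / 2 * 1"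
    using assms by (intro mult_left_mono) auto
  then have geo: "(\<Sum>i\<in>I. \<epsilon> / 2 * (1 / 2) ^ Suc i) \<le> \<epsilon> / 2"
    by (simp only: sum_distrib_left mult_1_right)
  have "(\<Sum>i\<in>I. ?\<omega> * (\<rho> i / 2) ^ k) \<le> (\<Sum>i\<in>I. ?\<omega> * (diameter (C i) / 2) ^ k + \<epsilon> / 2 * (1 / 2) ^ Suc i)"
    by (intro sum_mono \<rho>(3))
  also have "\<dots> = (\<Sum>i\<in>I. ?\<omega> * (diameter (C i) / 2) ^ k) + (\<Sum>i\<in>I. \<epsilon> / 2 * (1 / 2) ^ Suc i)"
    by (rule sum.distrib)
  also have "\<dots> \<le> h + \<epsilon>" using sum_D geo by linarith
  finally have total: "(\<Sum>i\<in>I. ?\<omega> * (\<rho> i / 2) ^ k) \<le> h + \<epsilon>" .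
  show thesis
  proof (rule that[OF I(2) _ I(3) total])
    fix i assume "i \<in> I"
    then show "c i \<in> A \<and> 0 < \<rho> i \<and> \<rho> i \<le> 2 * \<delta>"
      using c[of i] I(1) diam[of i] \<rho>(1)[of i] \<rho>(2)[of i] C(3)[of i] by auto
  qed
qed

text \<open>
  This lemma takes the place of the Gauss-Green formula on \<open>\<Omega>\<close>: the gradient of a suitable cutoff
  has mass controlled by the Hausdorff measure of the topological boundary. It
  is \<open>\<psi> = sq_pos (1 - \<zeta>)\<close> on \<open>\<Omega>\<close>, where \<open>\<zeta>\<close> is the sum of the bumps of a cover of the boundary.
\<close>

lemma boundary_cutoff:
  fixes \<Omega> :: "(real^'n) set"
  assumes \<Omega>: "open \<Omega>" "bounded \<Omega>" and K: "compact K" "K \<subseteq> \<Omega>"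
    and h: "hausdorff_measure (CARD('n) - 1) (frontier \<Omega>) = ennreal h" "0 \<le> h" and \<epsilon>: "0 < \<epsilon>"
  obtains \<psi> g where "\<And>x. (\<psi> has_derivative (\<lambda>v. g x \<bullet> v)) (at x)" "continuous_on UNIV g"
    "\<And>x. 0 \<le> \<psi> x" "\<And>x. x \<in> K \<Longrightarrow> \<psi> x = 1" "\<And>x. x \<notin> \<Omega> \<Longrightarrow> \<psi> x = 0" "\<And>x. x \<notin> \<Omega> \<Longrightarrow> g x = 0"
    "(LINT x|lborel. norm (g x)) \<le> cutoff_const CARD('n) * (h + \<epsilon>)"
proof -
  let ?d = "CARD('n)"
  have "compact (frontier \<Omega>)" using \<Omega>(2) by (rule compact_frontier_bounded)
  have "K \<inter> frontier \<Omega> = {}" using K \<Omega>(1) by (auto simp: frontier_def interior_open)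
  then obtain D where D: "0 < D" "\<And>x y. x \<in> K \<Longrightarrow> y \<in> frontier \<Omega> \<Longrightarrow> D \<le> dist x y"
    using separate_compact_closed[OF K(1) frontier_closed] by metis
  \<comment> \<open>radii at most \<open>D / 2\<close>, so that the bumps, supported in the doubled balls, do not reach \<open>K\<close>\<close>
  have "0 < D / 4" using D by simp
  obtain I :: "nat set" and c \<rho> where I: "finite I"
    and c: "\<And>i. i \<in> I \<Longrightarrow> c i \<in> frontier \<Omega> \<and> 0 < \<rho> i \<and> \<rho> i \<le> 2 * (D / 4)"
    and cover: "frontier \<Omega> \<subseteq> (\<Union>i\<in>I. ball (c i) (\<rho> i))"
    and total: "(\<Sum>i\<in>I. unit_ball_vol (real (?d - 1)) * (\<rho> i / 2) ^ (?d - 1)) \<le> h + \<epsilon>"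
    by (rule small_ball_cover[OF \<open>compact (frontier \<Omega>)\<close> h \<epsilon> \<open>0 < D / 4\<close>]) (rule that; assumption)
  define \<zeta> where "\<zeta> x = (\<Sum>i\<in>I. bump (c i) (\<rho> i) x)" for x
  define \<zeta>' where "\<zeta>' x = (\<Sum>i\<in>I. bump_grad (c i) (\<rho> i) x)" for x
  define \<psi> where "\<psi> x = (if x \<in> \<Omega> then sq_pos (1 - \<zeta> x) else 0)" for x
  define g where "g x = (if x \<in> \<Omega> then (- (2 * max 0 (1 - \<zeta> x))) *\<^sub>R \<zeta>' x else 0)" for x
  define W where "W = (\<Union>i\<in>I. ball (c i) (\<rho> i)) \<union> - closure \<Omega>"
  \<comment> \<open>\<open>\<psi>\<close> vanishes on the open set \<open>W\<close>, so the definitions on \<open>\<Omega>\<close> and on \<open>W\<close> fit together smoothly\<close>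
  have W: "open W" "\<Omega> \<union> W = UNIV"
    using cover \<Omega>(1) by (auto simp: W_def frontier_def interior_open)
  have \<zeta>0: "0 \<le> \<zeta> x" for x unfolding \<zeta>_def by (intro sum_nonneg bump_nonneg)
  have \<zeta>1: "1 \<le> \<zeta> x" if "x \<in> W" "x \<in> \<Omega>" for x
  proof -
    obtain i where i: "i \<in> I" "x \<in> ball (c i) (\<rho> i)" using \<open>x \<in> W\<close> \<open>x \<in> \<Omega>\<close> closure_subset by (auto simp: W_def)
    have "1 \<le> bump (c i) (\<rho> i) x" using i c[OF i(1)] by (intro bump_ge_1) (auto simp: dist_norm norm_minus_commute)
    also have "\<dots> \<le> \<zeta> x" unfolding \<zeta>_def using i I bump_nonneg by (intro member_le_sum) auto
    finally show ?thesis .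
  qed
  have W0: "\<psi> x = 0" "g x = 0" if "x \<in> W" for x
    using \<zeta>1[OF that] by (auto simp: \<psi>_def g_def sq_pos_bounds)
  have \<zeta>_deriv: "(\<zeta> has_derivative (\<lambda>v. \<zeta>' x \<bullet> v)) (at x)" for x
    unfolding \<zeta>_def[abs_def] \<zeta>'_def inner_sum_left by (intro has_derivative_sum bump_deriv)
  have \<zeta>_cont: "continuous_on UNIV \<zeta>"
    using \<zeta>_deriv by (meson continuous_at_imp_continuous_on has_derivative_continuous)
  have \<zeta>'_cont: "continuous_on UNIV \<zeta>'"
    unfolding \<zeta>'_def[abs_def] by (intro continuous_intros continuous_bump_grad)
  have deriv: "(\<psi> has_derivative (\<lambda>v. g x \<bullet> v)) (at x)" for x
  proof (cases "x \<in> \<Omega>")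
    case True
    have "((\<lambda>x. 1 - \<zeta> x) has_derivative (\<lambda>v. - (\<zeta>' x \<bullet> v))) (at x)"
      by (auto intro!: derivative_eq_intros \<zeta>_deriv)
    from has_derivative_compose[OF this sq_pos_deriv[unfolded has_field_derivative_def]]
    have "((\<lambda>x. sq_pos (1 - \<zeta> x)) has_derivative (\<lambda>v. g x \<bullet> v)) (at x)"
      by (rule has_derivative_eq_rhs) (simp add: g_def True fun_eq_iff)
    then show ?thesis
      by (rule has_derivative_transform_within_open[OF _ \<Omega>(1) True]) (simp add: \<psi>_def)
  next
    case False
    then have "x \<in> W" using W by blast
    have "((\<lambda>_. 0) has_derivative (\<lambda>v. g x \<bullet> v)) (at x)" using W0[OF \<open>x \<in> W\<close>] by simp
    then show ?thesis
      by (rule has_derivative_transform_within_open[OF _ W(1) \<open>x \<in> W\<close>]) (simp add: W0)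
  qed
  have g_cont: "continuous_on UNIV g"
  proof -
    have "continuous_on \<Omega> g"
      by (rule continuous_on_eq[of _ "\<lambda>x. (- (2 * max 0 (1 - \<zeta> x))) *\<^sub>R \<zeta>' x"])
         (auto simp: g_def intro!: continuous_intros intro: continuous_on_subset[OF \<zeta>_cont] continuous_on_subset[OF \<zeta>'_cont])
    moreover have "continuous_on W g"
      by (rule continuous_on_eq[of _ "\<lambda>_. 0"]) (auto simp: W0)
    ultimately show ?thesis using continuous_on_open_Un[OF \<Omega>(1) W(1)] W(2) by metis
  qed
  have g_norm: "norm (g x) \<le> 2 * (\<Sum>i\<in>I. norm (bump_grad (c i) (\<rho> i) x))" for x
  proof (cases "x \<in> \<Omega>")
    case True
    have "norm (g x) = 2 * max 0 (1 - \<zeta> x) * norm (\<zeta>' x)" using True by (simp add: g_def)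
    also have "\<dots> \<le> 2 * 1 * (\<Sum>i\<in>I. norm (bump_grad (c i) (\<rho> i) x))"
      unfolding \<zeta>'_def using \<zeta>0[of x] by (intro mult_mono norm_sum) auto
    finally show ?thesis by simp
  qed (simp add: g_def sum_nonneg)
  have "(LINT x|lborel. norm (g x)) \<le> (LINT x|lborel. 2 * (\<Sum>i\<in>I. norm (bump_grad (c i) (\<rho> i) x)))"
  proof (rule integral_mono[OF _ _ g_norm])
    show "integrable lborel (\<lambda>x. norm (g x))"
      by (rule integrable_continuous_compact_support[of _ "closure \<Omega>"])
         (use \<Omega>(2) g_cont closure_subset[of \<Omega>] in \<open>auto simp: g_def intro!: continuous_on_norm\<close>)
    show "integrable lborel (\<lambda>x. 2 * (\<Sum>i\<in>I. norm (bump_grad (c i) (\<rho> i) x)))"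
      using c by (intro integrable_mult_right Bochner_Integration.integrable_sum integral_norm_bump_grad(2)) auto
  qed
  also have "\<dots> = 2 * (\<Sum>i\<in>I. LINT x|lborel. norm (bump_grad (c i) (\<rho> i) x))"
    using c by (simp add: integral_norm_bump_grad)
  also have "\<dots> \<le> 2 * (\<Sum>i\<in>I. 16 * 2 ^ ?d * unit_ball_vol (real ?d) * \<rho> i ^ (?d - 1))"
    using c by (intro mult_left_mono sum_mono integral_norm_bump_grad) auto
  also have "\<dots> = 32 * 2 ^ ?d * unit_ball_vol (real ?d) * (\<Sum>i\<in>I. \<rho> i ^ (?d - 1))"
    by (simp add: sum_distrib_left mult_ac)
  also have "(\<Sum>i\<in>I. \<rho> i ^ (?d - 1)) = 2 ^ (?d - 1) / unit_ball_vol (real (?d - 1))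
      * (\<Sum>i\<in>I. unit_ball_vol (real (?d - 1)) * (\<rho> i / 2) ^ (?d - 1))"
    unfolding sum_distrib_left
    by (intro sum.cong refl) (simp add: power_divide unit_ball_vol_pos[THEN less_imp_neq, THEN not_sym])
  also have "32 * 2 ^ ?d * unit_ball_vol (real ?d) * (2 ^ (?d - 1) / unit_ball_vol (real (?d - 1))
      * (\<Sum>i\<in>I. unit_ball_vol (real (?d - 1)) * (\<rho> i / 2) ^ (?d - 1)))
      = cutoff_const ?d * (\<Sum>i\<in>I. unit_ball_vol (real (?d - 1)) * (\<rho> i / 2) ^ (?d - 1))"
    by (simp add: cutoff_const_def)
  also have "\<dots> \<le> cutoff_const ?d * (h + \<epsilon>)"
    using total cutoff_const_pos by (intro mult_left_mono) (auto intro: less_imp_le)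
  finally have mass: "(LINT x|lborel. norm (g x)) \<le> cutoff_const ?d * (h + \<epsilon>)" .
  show thesis
  proof (rule that[OF deriv g_cont _ _ _ _ mass])
    show "0 \<le> \<psi> x" for x by (simp add: \<psi>_def sq_pos_bounds)
    show "\<psi> x = 1" if "x \<in> K" for x
    proof -
      have "bump (c i) (\<rho> i) x = 0" if "i \<in> I" for i
        using D(2)[OF \<open>x \<in> K\<close>, of "c i"] c[OF that] by (intro bump_eq_0) (auto simp: dist_norm)
      then show ?thesis using that K(2) by (auto simp: \<psi>_def \<zeta>_def sq_pos_def)
    qed
  qed (auto simp: \<psi>_def g_def)
qed

section \<open>The total variation estimate\<close>

lemma trace_le:
  fixes \<Phi> :: "real^'n^'n"
  shows "\<bar>\<Sum>i\<in>UNIV. \<Phi> $ i $ i\<bar> \<le> sqrt (real CARD('n)) * norm \<Phi>"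
proof -
  have "(mat 1 :: real^'n^'n) \<bullet> mat 1 = (\<Sum>i\<in>(UNIV :: 'n set). 1)"
    by (simp add: inner_vec_def mat_def if_distrib[of "\<lambda>x. x * _"] cong: if_cong)
  then have "norm (mat 1 :: real^'n^'n) = sqrt (real CARD('n))"
    by (simp add: norm_eq_sqrt_inner)
  moreover have "(mat 1 :: real^'n^'n) \<bullet> \<Phi> = (\<Sum>i\<in>UNIV. \<Phi> $ i $ i)"
    by (simp add: inner_vec_def mat_def if_distrib[of "\<lambda>x. x * _"] cong: if_cong)
  ultimately show ?thesis
    using Cauchy_Schwarz_ineq2[of "mat 1" \<Phi>] by simp
qed

context hopf_lax
begin

text \<open>
  Since \<open>backward_slope = (x - foot x) / t\<close>, its variation is at most that of \<open>x / t\<close>, the volume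
  term, plus that of \<open>foot / t\<close>. For the latter, the divergence of \<open>foot\<close> tested with \<open>\<psi>\<close> does not
  change when a constant \<open>x0\<close> is subtracted from \<open>foot\<close>.
\<close>

lemma slope_variation_le:
  fixes \<phi> :: "real^'d \<Rightarrow> real^'d^'d"
  assumes V: "open V" "bounded V" and \<phi>: "\<phi> \<in> test_fields V"
    and \<psi>: "\<And>x. (\<psi> has_derivative (\<lambda>h. g x \<bullet> h)) (at x)" "continuous_on UNIV g"
    and supp: "\<And>x. x \<notin> W \<Longrightarrow> \<psi> x = 0" "\<And>x. x \<notin> W \<Longrightarrow> g x = 0" "bounded W"
    and le: "\<And>x. norm (\<phi> x) \<le> \<psi> x" and D: "\<And>x. x \<in> W \<Longrightarrow> norm (x - x0) \<le> D"
  shows "(\<Sum>\<alpha>\<in>UNIV. LINT x:V|lebesgue. backward_slope H u0 t x $ \<alpha> * div_vec (\<lambda>z. \<phi> z $ \<alpha>) x)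
    \<le> 1 / convexity_modulus H r * (R + D / t) * (LINT x|lborel. norm (g x))
       + sqrt (real CARD('d)) / t * measure lebesgue V"
proof -
  let ?\<kappa> = "convexity_modulus H r"
  let ?b = "backward_slope H u0 t"
  have \<kappa>: "0 < ?\<kappa>" by (rule modulus_pos[OF r_pos])
  define S where "S = closure {x. \<phi> x \<noteq> 0}"
  have C1: "C1_fun \<phi>" and S: "S \<subseteq> V" and \<phi>1: "\<And>x. norm (\<phi> x) \<le> 1"
    using \<phi> by (auto simp: test_fields_def S_def)
  have \<phi>S: "\<phi> x = 0" if "x \<notin> S" for x
    using that closure_subset[of "{x. \<phi> x \<noteq> 0}"] by (auto simp: S_def)
  obtain \<rho> where \<rho>: "0 < \<rho>" "V \<union> W \<subseteq> cball 0 \<rho>"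
    using bounded_subset_ballD[of "V \<union> W" 0] V(2) supp(3) ball_subset_cball by (meson bounded_Un order_trans)
  have \<phi>0: "\<phi> x = 0" if "x \<notin> cball 0 \<rho>" for x using that \<rho>(2) S \<phi>S by blast
  have \<psi>0: "\<psi> x = 0" if "x \<notin> cball 0 \<rho>" for x using that \<rho>(2) supp(1) by blast
  have g0: "g x = 0" if "x \<notin> cball 0 \<rho>" for x using that \<rho>(2) supp(2) by blast
  define dv where "dv \<alpha> x = div_vec (\<lambda>z. \<phi> z $ \<alpha>) x" for \<alpha> x
  have dv_cont: "continuous_on UNIV (dv \<alpha>)" for \<alpha>
    unfolding dv_def[abs_def] by (rule continuous_div_vec_row[OF C1])
  have dvS: "dv \<alpha> x = 0" if "x \<notin> S" for \<alpha> x
    unfolding dv_def using that by (intro div_vec_row_eq_0[OF C1, of S] \<phi>S) (auto simp: S_def)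
  have dv0: "dv \<alpha> x = 0" if "x \<notin> cball 0 \<rho>" for \<alpha> x using that \<rho>(2) S dvS by blast
  have bounded_times: "integrable lebesgue (\<lambda>x. f x \<bullet> G x)"
    if f: "f \<in> borel_measurable lebesgue" "\<And>x. x \<in> cball 0 \<rho> \<Longrightarrow> norm (f x) \<le> B"
      and G: "continuous_on UNIV G" "\<And>x. x \<notin> cball 0 \<rho> \<Longrightarrow> G x = 0" for f G :: "real^'d \<Rightarrow> real^'d" and B
  proof (rule Bochner_Integration.integrable_bound[of _ "\<lambda>x. B * norm (G x)"])
    have "integrable lborel (\<lambda>x. B * norm (G x))"
      by (rule integrable_continuous_compact_support[of _ "cball 0 \<rho>"])
         (use G in \<open>auto intro!: continuous_intros\<close>)
    then show "integrable lebesgue (\<lambda>x. B * norm (G x))" by (rule integrable_lebesgue_of_lborel)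
    have "G \<in> borel_measurable lborel" using G(1) by (simp add: borel_measurable_continuous_onI)
    then show "(\<lambda>x. f x \<bullet> G x) \<in> borel_measurable lebesgue"
      by (intro borel_measurable_inner[OF f(1) measurable_completion])
    show "AE x in lebesgue. norm (f x \<bullet> G x) \<le> norm (B * norm (G x))"
    proof (rule AE_I2)
      fix x
      show "norm (f x \<bullet> G x) \<le> norm (B * norm (G x))"
      proof (cases "x \<in> cball 0 \<rho>")
        case True
        have "\<bar>f x \<bullet> G x\<bar> \<le> norm (f x) * norm (G x)" by (rule Cauchy_Schwarz_ineq2)
        also have "\<dots> \<le> B * norm (G x)" using f(2)[OF True] by (rule mult_right_mono) simp
        also have "\<dots> \<le> \<bar>B * norm (G x)\<bar>" by (rule abs_ge_self)
        finally show ?thesis by simp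
      qed (simp add: G(2))
    qed
  qed
  have axis_cont: "continuous_on UNIV (\<lambda>x. axis \<alpha> (dv \<alpha> x) :: real^'d)" for \<alpha>
    unfolding axis_def
  proof (rule continuous_on_vec_lambda)
    fix i
    show "continuous_on UNIV (\<lambda>x. if i = \<alpha> then dv \<alpha> x else 0)"
      by (cases "i = \<alpha>") (simp_all add: dv_cont)
  qed
  have axis_zero: "axis \<alpha> (dv \<alpha> x) = (0 :: real^'d)" if "x \<notin> cball 0 \<rho>" for \<alpha> x
    using dv0[OF that] by (simp add: axis_eq_0_iff)
  have foot_meas: "foot \<in> borel_measurable lebesgue"
    by (intro borel_measurable_diff borel_measurable_id_lebesgue
      borel_measurable_scaleR[OF borel_measurable_const backward_slope_measurable])
  have foot_near: "norm (foot x - x) \<le> t * R" for x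
    using norm_backward_slope[of x] t_pos by simp
  have foot_bound: "norm (foot x) \<le> \<rho> + t * R" if "x \<in> cball 0 \<rho>" for x
    using foot_near[of x] that norm_triangle_sub[of "foot x" x] by simp
  have i_x: "integrable lebesgue (\<lambda>x. x $ \<alpha> * dv \<alpha> x)" for \<alpha>
    using bounded_times[OF borel_measurable_id_lebesgue _ axis_cont axis_zero, of \<rho> \<alpha>]
    by (simp add: inner_axis)
  have i_foot: "integrable lebesgue (\<lambda>x. foot x $ \<alpha> * dv \<alpha> x)" for \<alpha>
    using bounded_times[OF foot_meas foot_bound axis_cont axis_zero, of \<alpha>]
    by (simp add: inner_axis)
  have g_int: "integrable lebesgue (\<lambda>x. foot x \<bullet> g x)"
    by (rule bounded_times[OF foot_meas foot_bound \<psi>(2) g0])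
  have x0_int: "integrable lebesgue (\<lambda>x. x0 \<bullet> g x)"
    by (rule bounded_times[OF borel_measurable_const order_refl \<psi>(2) g0])
  have split: "(\<Sum>\<alpha>\<in>UNIV. LINT x:V|lebesgue. ?b x $ \<alpha> * div_vec (\<lambda>z. \<phi> z $ \<alpha>) x)
    = 1 / t * ((\<Sum>\<alpha>\<in>UNIV. LINT x|lebesgue. x $ \<alpha> * dv \<alpha> x) - (\<Sum>\<alpha>\<in>UNIV. LINT x|lebesgue. foot x $ \<alpha> * dv \<alpha> x))"
  proof -
    have "(LINT x:V|lebesgue. ?b x $ \<alpha> * div_vec (\<lambda>z. \<phi> z $ \<alpha>) x)
      = 1 / t * ((LINT x|lebesgue. x $ \<alpha> * dv \<alpha> x) - (LINT x|lebesgue. foot x $ \<alpha> * dv \<alpha> x))" for \<alpha>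
    proof -
      have "indicator V x *\<^sub>R (?b x $ \<alpha> * dv \<alpha> x) = 1 / t * (x $ \<alpha> * dv \<alpha> x - foot x $ \<alpha> * dv \<alpha> x)" for x
        using dvS[of x \<alpha>] S t_pos by (cases "x \<in> S") (auto simp: indicator_def field_simps)
      then have "(LINT x:V|lebesgue. ?b x $ \<alpha> * dv \<alpha> x) = (LINT x|lebesgue. 1 / t * (x $ \<alpha> * dv \<alpha> x - foot x $ \<alpha> * dv \<alpha> x))"
        unfolding set_lebesgue_integral_def by simp
      also have "\<dots> = 1 / t * ((LINT x|lebesgue. x $ \<alpha> * dv \<alpha> x) - (LINT x|lebesgue. foot x $ \<alpha> * dv \<alpha> x))"
        using i_x i_foot by (simp only: integral_mult_right_zero Bochner_Integration.integral_diff)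
      finally show ?thesis by (simp add: dv_def)
    qed
    then show ?thesis by (simp only: sum_distrib_left[symmetric] sum_subtractf)
  qed
  have volume: "(\<Sum>\<alpha>\<in>UNIV. LINT x|lebesgue. x $ \<alpha> * dv \<alpha> x) \<le> sqrt (real CARD('d)) * measure lebesgue V"
  proof -
    have c\<phi>: "continuous_on UNIV \<phi>"
      using C1_fun_derivative[OF C1] by (meson continuous_at_imp_continuous_on has_derivative_continuous)
    have "(\<Sum>\<alpha>\<in>UNIV. LINT x|lebesgue. x $ \<alpha> * dv \<alpha> x) = (\<Sum>\<alpha>\<in>UNIV. LINT x|lborel. x $ \<alpha> * dv \<alpha> x)"
      by (intro sum.cong refl integral_completion)
         (simp add: borel_measurable_continuous_onI continuous_on_mult continuous_on_component dv_cont)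
    also have "\<dots> = - (LINT x|lborel. (\<Sum>\<alpha>\<in>UNIV. \<Sum>i\<in>UNIV. (axis i 1 :: real^'d) $ \<alpha> * \<phi> x $ \<alpha> $ i))"
      unfolding dv_def by (rule integral_div_by_parts[where Y = "\<lambda>x. x" and Y' = "\<lambda>_ h. h", OF _ _ C1 \<phi>0]) auto
    also have "\<dots> = (LINT x|lborel. - (\<Sum>\<alpha>\<in>UNIV. \<phi> x $ \<alpha> $ \<alpha>))"
      by (simp add: axis_def if_distrib[of "\<lambda>x. x * _"] cong: if_cong)
    also have "\<dots> \<le> (LINT x|lborel. indicator V x *\<^sub>R sqrt (real CARD('d)))"
    proof (rule integral_mono)
      show "integrable lborel (\<lambda>x. - (\<Sum>\<alpha>\<in>UNIV. \<phi> x $ \<alpha> $ \<alpha>))"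
        by (rule integrable_continuous_compact_support[of _ "cball 0 \<rho>"])
           (use \<phi>0 in \<open>auto intro!: continuous_intros c\<phi>\<close>)
      show "integrable lborel (\<lambda>x. indicator V x *\<^sub>R sqrt (real CARD('d)))"
        using V emeasure_bounded_finite[OF V(2)]
        by (intro integrable_scaleR_left integrable_real_indicator) auto
      fix x
      have "- (\<Sum>\<alpha>\<in>UNIV. \<phi> x $ \<alpha> $ \<alpha>) \<le> sqrt (real CARD('d)) * norm (\<phi> x)"
        using trace_le[of "\<phi> x"] by linarith
      also have "\<dots> \<le> indicator V x *\<^sub>R sqrt (real CARD('d))"
      proof (cases "x \<in> V")
        case True
        then show ?thesis using mult_left_mono[OF \<phi>1[of x], of "sqrt (real CARD('d))"] by simp
      next
        case False
        then have "\<phi> x = 0" using \<phi>S S by blast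
        then show ?thesis by simp
      qed
      finally show "- (\<Sum>\<alpha>\<in>UNIV. \<phi> x $ \<alpha> $ \<alpha>) \<le> indicator V x *\<^sub>R sqrt (real CARD('d))" .
    qed
    also have "\<dots> = sqrt (real CARD('d)) * measure lebesgue V"
      using V(1) by simp
    finally show ?thesis .
  qed
  have "?\<kappa> * - (\<Sum>\<alpha>\<in>UNIV. LINT x|lebesgue. foot x $ \<alpha> * dv \<alpha> x) \<le> - (LINT x|lebesgue. foot x \<bullet> g x)"
    unfolding dv_def by (rule foot_derivative_le_divergence[OF C1 \<phi>0 \<psi> \<psi>0 le \<rho>(1)])
  also have "\<dots> = (LINT x|lebesgue. (x0 - foot x) \<bullet> g x)"
  proof -
    have g_cont_comp: "continuous_on UNIV (\<lambda>x. g x \<bullet> x0)" by (intro continuous_intros \<psi>(2))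
    have "(LINT x|lborel. g x \<bullet> x0) = 0"
      by (rule integral_derivative_compact_support[OF \<psi>(1) g_cont_comp \<psi>0])
    moreover have "(LINT x|lebesgue. g x \<bullet> x0) = (LINT x|lborel. g x \<bullet> x0)"
      using g_cont_comp by (intro integral_completion) (simp add: borel_measurable_continuous_onI)
    ultimately have "(LINT x|lebesgue. x0 \<bullet> g x) = 0" by (simp add: inner_commute)
    then show ?thesis
      using x0_int g_int by (simp add: inner_diff_left)
  qed
  also have "\<dots> \<le> (LINT x|lebesgue. (D + t * R) * norm (g x))"
  proof (rule integral_mono)
    show "integrable lebesgue (\<lambda>x. (x0 - foot x) \<bullet> g x)"
      using x0_int g_int by (simp add: inner_diff_left)
    have "integrable lborel (\<lambda>x. (D + t * R) * norm (g x))"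
      by (rule integrable_continuous_compact_support[of _ "cball 0 \<rho>"])
         (use g0 \<psi>(2) in \<open>auto intro!: continuous_intros\<close>)
    then show "integrable lebesgue (\<lambda>x. (D + t * R) * norm (g x))" by (rule integrable_lebesgue_of_lborel)
    fix x
    show "(x0 - foot x) \<bullet> g x \<le> (D + t * R) * norm (g x)"
    proof (cases "x \<in> W")
      case True
      have "norm (x0 - foot x) \<le> norm (x0 - x) + norm (x - foot x)"
        using dist_triangle[of x0 "foot x" x] by (simp only: dist_norm)
      then have "norm (x0 - foot x) \<le> D + t * R"
        using D[OF True] foot_near[of x] by (simp add: norm_minus_commute)
      then show ?thesis
        using norm_cauchy_schwarz[of "x0 - foot x" "g x"] by (meson mult_right_mono norm_ge_zero order_trans)
    qed (simp add: supp(2))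
  qed
  also have "\<dots> = (D + t * R) * (LINT x|lborel. norm (g x))"
    using \<psi>(2) by (simp add: integral_completion borel_measurable_continuous_onI continuous_on_norm)
  finally have "- (\<Sum>\<alpha>\<in>UNIV. LINT x|lebesgue. foot x $ \<alpha> * dv \<alpha> x) \<le> (D + t * R) * (LINT x|lborel. norm (g x)) / ?\<kappa>"
    using \<kappa> by (simp add: pos_le_divide_eq mult.commute)
  with volume have "(\<Sum>\<alpha>\<in>UNIV. LINT x|lebesgue. x $ \<alpha> * dv \<alpha> x) - (\<Sum>\<alpha>\<in>UNIV. LINT x|lebesgue. foot x $ \<alpha> * dv \<alpha> x)
    \<le> sqrt (real CARD('d)) * measure lebesgue V + (D + t * R) * (LINT x|lborel. norm (g x)) / ?\<kappa>"
    by linarith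
  then have "1 / t * ((\<Sum>\<alpha>\<in>UNIV. LINT x|lebesgue. x $ \<alpha> * dv \<alpha> x) - (\<Sum>\<alpha>\<in>UNIV. LINT x|lebesgue. foot x $ \<alpha> * dv \<alpha> x))
    \<le> 1 / t * (sqrt (real CARD('d)) * measure lebesgue V + (D + t * R) * (LINT x|lborel. norm (g x)) / ?\<kappa>)"
    using t_pos by (intro mult_left_mono) auto
  also have "\<dots> = 1 / ?\<kappa> * (R + D / t) * (LINT x|lborel. norm (g x)) + sqrt (real CARD('d)) / t * measure lebesgue V"
    using t_pos \<kappa> by (simp add: field_simps)
  finally show ?thesis unfolding split .
qed

text \<open>
  For the local bound one fixed cutoff that dominates all test fields on \<open>V\<close> is enough.
\<close>

lemma locally_BV_backward_slope: "locally_BV (backward_slope H u0 t)"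
  unfolding locally_BV_def
proof (intro conjI allI impI)
  fix K :: "(real^'d) set" assume K: "compact K"
  have K_sets: "K \<in> sets lebesgue" "emeasure lebesgue K < \<infinity>"
    using K emeasure_bounded_finite[OF compact_imp_bounded[OF K]] by (auto simp: borel_compact)
  show "set_integrable lebesgue K (backward_slope H u0 t)"
    unfolding set_integrable_def
  proof (rule Bochner_Integration.integrable_bound[of _ "\<lambda>x. R * indicator K x"])
    show "integrable lebesgue (\<lambda>x. R * indicator K x)" using K_sets by simp
    show "(\<lambda>x. indicator K x *\<^sub>R backward_slope H u0 t x) \<in> borel_measurable lebesgue"
      using K_sets by (intro borel_measurable_scaleR backward_slope_measurable borel_measurable_indicator)
    show "AE x in lebesgue. norm (indicator K x *\<^sub>R backward_slope H u0 t x) \<le> norm (R * indicator K x)"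
      using norm_backward_slope R_pos by (intro AE_I2) (auto simp: indicator_def)
  qed
next
  fix V :: "(real^'d) set" assume V: "open V" "bounded V"
  obtain \<rho> where \<rho>: "0 < \<rho>" "V \<subseteq> cball 0 \<rho>"
    using bounded_subset_ballD[OF V(2)] ball_subset_cball by (meson order_trans)
  let ?B = "1 / convexity_modulus H r * (R + 2 * \<rho> / t) * (LINT x|lborel. norm (bump_grad (0::real^'d) \<rho> x))
       + sqrt (real CARD('d)) / t * measure lebesgue V"
  have "total_variation (backward_slope H u0 t) V \<le> ennreal ?B"
    unfolding total_variation_def
  proof (intro SUP_least ennreal_leI slope_variation_le[OF V _ bump_deriv continuous_bump_grad, where W = "cball 0 (2 * \<rho>)" and ?x0.0 = 0])
    fix \<phi> :: "real^'d \<Rightarrow> real^'d^'d" and x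
    assume \<phi>: "\<phi> \<in> test_fields V"
    show "norm (\<phi> x) \<le> bump 0 \<rho> x"
    proof (cases "x \<in> V")
      case True
      then have "1 \<le> bump 0 \<rho> x" using \<rho> by (intro bump_ge_1) auto
      moreover have "norm (\<phi> x) \<le> 1" using \<phi> by (simp add: test_fields_def)
      ultimately show ?thesis by linarith
    next
      case False
      then have "\<phi> x = 0" using \<phi> closure_subset[of "{x. \<phi> x \<noteq> 0}"] by (auto simp: test_fields_def)
      then show ?thesis by (simp add: bump_nonneg)
    qed
  next
    fix x :: "real^'d" assume "x \<notin> cball 0 (2 * \<rho>)"
    then show "bump 0 \<rho> x = 0" "bump_grad 0 \<rho> x = 0"
      using \<rho>(1) norm_bump_grad[OF \<rho>(1), of 0 x] by (auto intro: bump_eq_0)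
  qed auto
  also have "\<dots> < \<infinity>" by simp
  finally show "total_variation (backward_slope H u0 t) V < \<infinity>" .
qed

lemma total_variation_backward_slope:
  assumes \<Omega>: "open \<Omega>" "bounded \<Omega>"
  shows "total_variation (backward_slope H u0 t) \<Omega>
    \<le> ennreal (1 / (convexity_modulus H r / cutoff_const CARD('d)) * (R + diameter \<Omega> / t)) * hausdorff_measure (CARD('d) - 1) (frontier \<Omega>)
      + ennreal (sqrt (real CARD('d)) / t) * emeasure lebesgue \<Omega>"
proof -
  define a where "a = 1 / convexity_modulus H r * (R + diameter \<Omega> / t)"
  have a: "0 < a"
    using modulus_pos[OF r_pos] R_pos t_pos diameter_ge_0[OF \<Omega>(2)]
    unfolding a_def by (intro mult_pos_pos add_pos_nonneg) auto
  have coeff: "1 / (convexity_modulus H r / cutoff_const CARD('d)) * (R + diameter \<Omega> / t) = a * cutoff_const CARD('d)"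
    by (simp add: a_def)
  show ?thesis
  proof (cases "hausdorff_measure (CARD('d) - 1) (frontier \<Omega>)")
    case top
    \<comment> \<open>the coefficient is positive, so the right hand side is infinite\<close>
    then show ?thesis
      unfolding coeff using mult_pos_pos[OF a cutoff_const_pos[of "CARD('d)"]] by (simp add: ennreal_mult_top ennreal_eq_0_iff not_le)
  next
    case (real h)
    have "emeasure lebesgue \<Omega> = ennreal (measure lebesgue \<Omega>)"
      using emeasure_bounded_finite[OF \<Omega>(2)] \<Omega>(1) by (intro emeasure_eq_ennreal_measure) auto
    then have rhs: "ennreal (a * cutoff_const CARD('d)) * hausdorff_measure (CARD('d) - 1) (frontier \<Omega>)
        + ennreal (sqrt (real CARD('d)) / t) * emeasure lebesgue \<Omega>
      = ennreal (a * cutoff_const CARD('d) * h + sqrt (real CARD('d)) / t * measure lebesgue \<Omega>)"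
      using real a t_pos cutoff_const_pos[of "CARD('d)"]
      by (simp only: ennreal_mult[symmetric] ennreal_plus[symmetric] mult_nonneg_nonneg less_imp_le
          divide_nonneg_pos real_sqrt_ge_zero of_nat_0_le_iff measure_nonneg)
    show ?thesis
      unfolding coeff rhs total_variation_def
    proof (intro SUP_least ennreal_leI)
      fix \<phi> :: "real^'d \<Rightarrow> real^'d^'d" assume \<phi>: "\<phi> \<in> test_fields \<Omega>"
      define S where "S = closure {x. \<phi> x \<noteq> 0}"
      have S: "compact S" "S \<subseteq> \<Omega>" and \<phi>1: "\<And>x. norm (\<phi> x) \<le> 1"
        using \<phi> by (auto simp: test_fields_def S_def)
      let ?I = "\<Sum>\<alpha>\<in>UNIV. LINT x:\<Omega>|lebesgue. backward_slope H u0 t x $ \<alpha> * div_vec (\<lambda>z. \<phi> z $ \<alpha>) x"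
      have "?I \<le> a * cutoff_const CARD('d) * (h + \<epsilon>) + sqrt (real CARD('d)) / t * measure lebesgue \<Omega>" if \<epsilon>: "0 < \<epsilon>" for \<epsilon>
      proof -
        obtain \<psi> g where \<psi>: "\<And>x. (\<psi> has_derivative (\<lambda>v. g x \<bullet> v)) (at x)" "continuous_on UNIV g"
          "\<And>x. 0 \<le> \<psi> x" "\<And>x. x \<in> S \<Longrightarrow> \<psi> x = 1" "\<And>x. x \<notin> \<Omega> \<Longrightarrow> \<psi> x = 0" "\<And>x. x \<notin> \<Omega> \<Longrightarrow> g x = 0"
          "(LINT x|lborel. norm (g x)) \<le> cutoff_const CARD('d) * (h + \<epsilon>)"
          by (rule boundary_cutoff[OF \<Omega> S real(2,1) \<epsilon>]) (rule that; assumption)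
        have "norm (\<phi> x) \<le> \<psi> x" for x
        proof (cases "x \<in> S")
          case False
          then have "\<phi> x = 0" using closure_subset[of "{x. \<phi> x \<noteq> 0}"] by (auto simp: S_def)
          then show ?thesis using \<psi>(3) by simp
        qed (simp add: \<psi>(4) \<phi>1)
        \<comment> \<open>any point of \<open>\<Omega>\<close> serves as the constant; for empty \<open>\<Omega>\<close> the condition on it is void\<close>
        moreover have "norm (x - (SOME x. x \<in> \<Omega>)) \<le> diameter \<Omega>" if "x \<in> \<Omega>" for x
          using diameter_bounded_bound[OF \<Omega>(2) that someI[of "\<lambda>x. x \<in> \<Omega>", OF that]] by (simp add: dist_norm)
        ultimately have "?I \<le> a * (LINT x|lborel. norm (g x)) + sqrt (real CARD('d)) / t * measure lebesgue \<Omega>"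
          unfolding a_def by (intro slope_variation_le[OF \<Omega> \<phi> \<psi>(1,2,5,6) \<Omega>(2)])
        also have "a * (LINT x|lborel. norm (g x)) \<le> a * (cutoff_const CARD('d) * (h + \<epsilon>))"
          using \<psi>(7) a by (intro mult_left_mono) auto
        finally show ?thesis by (simp add: mult.assoc)
      qed
      note bound = this
      show "?I \<le> a * cutoff_const CARD('d) * h + sqrt (real CARD('d)) / t * measure lebesgue \<Omega>"
      proof (rule field_le_epsilon)
        fix e :: real assume "0 < e"
        define c where "c = a * cutoff_const CARD('d)"
        have "0 < c" using a cutoff_const_pos by (simp add: c_def)
        then have "c * (h + e / c) = c * h + e" by (simp add: distrib_left)
        then show "?I \<le> a * cutoff_const CARD('d) * h + sqrt (real CARD('d)) / t * measure lebesgue \<Omega> + e"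
          using bound[of "e / c"] \<open>0 < c\<close> \<open>0 < e\<close> unfolding c_def[symmetric] by simp
      qed
    qed
  qed
qed

end

theorem theorem1p2:
  fixes H :: "real^'d \<Rightarrow> real"
  assumes "assumption_A H" and "assumption_B H"
  shows "\<forall>M>0. \<exists>\<gamma>>0. \<exists>\<Lambda>>0. \<forall>t>0. \<forall>u0 :: real^'d \<Rightarrow> real. M-lipschitz_on UNIV u0 \<longrightarrow>
     locally_BV (backward_slope H u0 t) \<and>
     (\<forall>\<Omega>. open \<Omega> \<longrightarrow> bounded \<Omega> \<longrightarrow> finite_perimeter \<Omega> \<longrightarrow>
        total_variation (backward_slope H u0 t) \<Omega>
        \<le> ennreal (1 / \<gamma> * (\<Lambda> + diameter \<Omega> / t)) * hausdorff_measure (CARD('d) - 1) (frontier \<Omega>)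
          + ennreal (sqrt (real CARD('d)) / t) * emeasure lebesgue \<Omega>)"
proof (intro allI impI)
  fix M :: real assume "0 < M"
  interpret hamiltonian H by unfold_locales (fact assms)+
  obtain R where R: "0 < R" "\<And>q. legendre H q \<le> M * norm q + legendre H 0 + 1 \<Longrightarrow> norm q \<le> R"
    using speed_bound[of M] \<open>0 < M\<close> by auto
  obtain r where r: "0 < r" "\<And>q. norm q \<le> R \<Longrightarrow> norm (dual q) \<le> r"
    using dual_bounded by blast
  let ?\<gamma> = "convexity_modulus H r / cutoff_const CARD('d)"
  show "\<exists>\<gamma>>0. \<exists>\<Lambda>>0. \<forall>t>0. \<forall>u0 :: real^'d \<Rightarrow> real. M-lipschitz_on UNIV u0 \<longrightarrow>
     locally_BV (backward_slope H u0 t) \<and>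
     (\<forall>\<Omega>. open \<Omega> \<longrightarrow> bounded \<Omega> \<longrightarrow> finite_perimeter \<Omega> \<longrightarrow>
        total_variation (backward_slope H u0 t) \<Omega>
        \<le> ennreal (1 / \<gamma> * (\<Lambda> + diameter \<Omega> / t)) * hausdorff_measure (CARD('d) - 1) (frontier \<Omega>)
          + ennreal (sqrt (real CARD('d)) / t) * emeasure lebesgue \<Omega>)"
  proof (rule exI[of _ ?\<gamma>], rule conjI[rotated], rule exI[of _ R], intro conjI allI impI)
    show "0 < ?\<gamma>" using modulus_pos[OF r(1)] cutoff_const_pos by simp
    show "0 < R" by (rule R(1))
    fix t :: real and u0 :: "real^'d \<Rightarrow> real" assume "0 < t" "M-lipschitz_on UNIV u0"
    then interpret hopf_lax H u0 M t R r
      using R r by unfold_locales auto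
    show "locally_BV (backward_slope H u0 t)" by (rule locally_BV_backward_slope)
    fix \<Omega> :: "(real^'d) set" assume "open \<Omega>" "bounded \<Omega>"
    then show "total_variation (backward_slope H u0 t) \<Omega>
        \<le> ennreal (1 / ?\<gamma> * (R + diameter \<Omega> / t)) * hausdorff_measure (CARD('d) - 1) (frontier \<Omega>)
          + ennreal (sqrt (real CARD('d)) / t) * emeasure lebesgue \<Omega>"
      by (rule total_variation_backward_slope)
  qed
qed

end
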